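(* Let $G,F$ be Polish spaces and let $(Z_n,Y_n)_{n\in\mathbb{Z}}$ be a stationary process in $G\times F$. With $\mathbf{P}_y^{z_-}$, $\mathbf{Q}$, $\mathcal{F}^Z_{n,\infty}$ and $\mathcal{A}^Z$ defined as in the context, the following are equivalent. 1. For $\mathbf{Q}$-a.e. $(z,z',y)$, we have $\|\mathbf{P}_y^{z_-}-\mathbf{P}_y^{z'_-}\|_{\mathcal{F}^Z_{n,\infty}}\to 0$ as $n\to\infty$. 2. For $\mathbf{Q}$-a.e. $(z,z',y)$, we have $\mathbf{P}_y^{z_-}(A)=\mathbf{P}_y^{z_-}(A)^2=\mathbf{P}_y^{z'_-}(A)$ for all $A\in\mathcal{A}^Z$. 3. For $\mathbf{Q}$-a.e. $(z,z',y)$, there exists $n\ge 0$ such that $\mathbf{P}_y^{z_-}$ and $\mathbf{P}_y^{z'_-}$ are not mutually singular on $\mathcal{F}^Z_{n,\infty}$.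
   Context: $G,F$ are Polish spaces, $\Omega=(G\times F)^{\mathbb{Z}}$ with its Borel $\sigma$-field $\mathcal{F}$, and $(Z_n,Y_n)_{n\in\mathbb{Z}}$ is the coordinate process. $\mathbf{P}$ is a stationary (shift-invariant) probability on $(\Omega,\mathcal{F})$. For $m\le n$ (infinite values allowed), $\mathcal{F}^Z_{m,n}=\sigma\{Z_k:m\le k\le n\}$, $\mathcal{F}^Y_{m,n}=\sigma\{Y_k:m\le k\le n\}$, $\mathcal{F}^Y=\mathcal{F}^Y_{-\infty,\infty}$, and $\mathcal{A}^Z=\bigcap_{n\ge 0}\mathcal{F}^Z_{n,\infty}$. Write $Z=(Z_n)_{n\in\mathbb{Z}}$, $Y=(Y_n)_{n\in\mathbb{Z}}$, and $z_-=(z_n)_{n\le 0}$ for a sequence $z=(z_n)_{n\in\mathbb{Z}}$. Let $\mathbf{Y}=\mathbf{P}[Y\in\cdot\,]$ and fix versions of the regular conditional probabilities $\mathbf{P}_y$ and $\mathbf{P}_y^{z_-}$ with $$\mathbf{P}_Y=\mathbf{P}[\,\cdot\,|\mathcal{F}^Y],\qquad \mathbf{P}_Y^{Z_-}=\mathbf{P}[\,\cdot\,|\mathcal{F}^Y\vee\mathcal{F}^Z_{-\infty,0}].$$ The probability $\mathbf{Q}$ on $G^{\mathbb{Z}}\times G^{\mathbb{Z}}\times F^{\mathbb{Z}}$ is defined by $$\int\mathbf{1}_A(z,z',y)\,\mathbf{Q}(dz,dz',dy)=\int\mathbf{1}_A(z,z',y)\,\mathbf{P}_y(Z\in dz)\,\mathbf{P}_y(Z\in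 dz')\,\mathbf{Y}(dy).$$ For probability measures $\mu,\nu$ and a $\sigma$-field $\mathcal{G}$, $\|\mu-\nu\|_{\mathcal{G}}=2\sup_{A\in\mathcal{G}}|\mu(A)-\nu(A)|$. *)

theory Defs
  imports "HOL-Probability.Probability"
begin

text \<open>
  The canonical path space \<open>\<Omega> = (G \<times> F)\<^sup>\<int>\<close> is the type \<open>int \<Rightarrow> 'g \<times> 'f\<close>. Its Borel sigma-field is
  \<open>sets borel\<close> for the product topology, which is the product sigma-field by
  \<open>sets_PiM_equal_borel\<close>. A sigma-field that is used for conditioning is represented by a
  measure, of which only the space and the measurable sets matter.
\<close>

type_synonym ('g, 'f) path = "int \<Rightarrow> 'g \<times> 'f"

definition Z_coord :: "int \<Rightarrow> ('g, 'f) path \<Rightarrow> 'g" where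
  "Z_coord n \<omega> = fst (\<omega> n)"

definition Y_coord :: "int \<Rightarrow> ('g, 'f) path \<Rightarrow> 'f" where
  "Y_coord n \<omega> = snd (\<omega> n)"

definition Z_path :: "('g, 'f) path \<Rightarrow> int \<Rightarrow> 'g" where
  "Z_path \<omega> = (\<lambda>n. Z_coord n \<omega>)"

definition Y_path :: "('g, 'f) path \<Rightarrow> int \<Rightarrow> 'f" where
  "Y_path \<omega> = (\<lambda>n. Y_coord n \<omega>)"

text \<open>The past \<open>z\<^sub>- = (z\<^sub>n)\<^sub>n\<^sub>\<le>\<^sub>0\<close>, with index \<open>k\<close> of the result standing for time \<open>- k\<close>.\<close>

definition past :: "(int \<Rightarrow> 'g) \<Rightarrow> nat \<Rightarrow> 'g" where
  "past z = (\<lambda>k. z (- int k))"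

definition stationary :: "(int \<Rightarrow> 'a) measure \<Rightarrow> bool" where
  "stationary P \<longleftrightarrow> distr P P (\<lambda>\<omega> n. \<omega> (n + 1)) = P"

text \<open>\<open>field_of X I\<close> is \<open>\<sigma>{X\<^sub>k : k \<in> I}\<close>; the time sets \<open>{m..n}\<close>, \<open>{n..}\<close>, \<open>{..n}\<close> and \<open>UNIV\<close> cover finite
  and infinite end points.\<close>

definition field_of :: "(int \<Rightarrow> 'w \<Rightarrow> 'b::topological_space) \<Rightarrow> int set \<Rightarrow> 'w measure" where
  "field_of X I = sigma UNIV {X k -` B | k B. k \<in> I \<and> B \<in> sets borel}"

abbreviation F_Z :: "int set \<Rightarrow> ('g::topological_space, 'f) path measure" where
  "F_Z \<equiv> field_of Z_coord"

abbreviation F_Y :: "int set \<Rightarrow> ('g, 'f::topological_space) path measure" where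
  "F_Y \<equiv> field_of Y_coord"

definition field_join :: "'w measure \<Rightarrow> 'w measure \<Rightarrow> 'w measure" where
  "field_join M N = sigma UNIV (sets M \<union> sets N)"

definition tail_Z :: "('g::topological_space, 'f) path set set" where
  "tail_Z = (\<Inter>n::nat. sets (F_Z {int n..}))"

text \<open>\<open>\<kappa>\<close> is a version of the regular conditional probability \<open>P[\<cdot> | H]\<close>, represented as a kernel \<open>\<kappa>\<^sub>X\<close>
  in a random variable \<open>X\<close>.\<close>

definition regular_cond_prob ::
    "'w measure \<Rightarrow> 'w measure \<Rightarrow> ('w \<Rightarrow> 'b::topological_space) \<Rightarrow> ('b \<Rightarrow> 'w measure) \<Rightarrow> bool" where
  "regular_cond_prob P H X \<kappa> \<longleftrightarrow>
     \<kappa> \<in> borel \<rightarrow>\<^sub>M prob_algebra P \<and>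
     (\<forall>A\<in>sets P. AE \<omega> in P. measure (\<kappa> (X \<omega>)) A = real_cond_exp P H (indicator A) \<omega>)"

text \<open>The law of \<open>(z, z', y)\<close> when \<open>y\<close> has the law of \<open>Y\<close> and, given \<open>y\<close>, the sequences \<open>z\<close> and \<open>z'\<close> are
  independent with law \<open>P\<^sub>y(Z \<in> \<cdot>)\<close>; see \<open>emeasure_coupling\<close>.\<close>

definition coupling ::
    "('g::topological_space, 'f::topological_space) path measure \<Rightarrow>
     ((int \<Rightarrow> 'f) \<Rightarrow> ('g, 'f) path measure) \<Rightarrow>
     ((int \<Rightarrow> 'g) \<times> (int \<Rightarrow> 'g) \<times> (int \<Rightarrow> 'f)) measure" where
  "coupling P \<kappa> = do {
     y \<leftarrow> distr P borel Y_path;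
     z \<leftarrow> distr (\<kappa> y) borel Z_path;
     z' \<leftarrow> distr (\<kappa> y) borel Z_path;
     return borel (z, z', y)
   }"

definition tv_on :: "'w set set \<Rightarrow> 'w measure \<Rightarrow> 'w measure \<Rightarrow> real" where
  "tv_on \<G> \<mu> \<nu> = 2 * (SUP A\<in>\<G>. \<bar>measure \<mu> A - measure \<nu> A\<bar>)"

definition mutually_singular_on :: "'w set set \<Rightarrow> 'w measure \<Rightarrow> 'w measure \<Rightarrow> bool" where
  "mutually_singular_on \<G> \<mu> \<nu> \<longleftrightarrow> (\<exists>A\<in>\<G>. measure \<mu> A = 0 \<and> measure \<nu> (- A) = 0)"

lemma measurable_Z_path [measurable]:
  "(Z_path :: ('g::second_countable_topology, 'f::second_countable_topology) path \<Rightarrow> _)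
     \<in> borel \<rightarrow>\<^sub>M borel"
  unfolding Z_path_def Z_coord_def
  by (intro borel_measurable_continuous_onI continuous_on_coordinatewise_then_product
      continuous_intros continuous_on_product_coordinates)

lemma measurable_Y_path [measurable]:
  "(Y_path :: ('g::second_countable_topology, 'f::second_countable_topology) path \<Rightarrow> _)
     \<in> borel \<rightarrow>\<^sub>M borel"
  unfolding Y_path_def Y_coord_def
  by (intro borel_measurable_continuous_onI continuous_on_coordinatewise_then_product
      continuous_intros continuous_on_product_coordinates)

lemma emeasure_coupling:
  fixes P :: "('g::polish_space, 'f::polish_space) path measure"
  assumes P: "prob_space P" "sets P = sets borel"
    and \<kappa>: "\<kappa> \<in> borel \<rightarrow>\<^sub>M prob_algebra P"
    and A: "A \<in> sets borel"
  shows "emeasure (coupling P \<kappa>) A =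
    (\<integral>\<^sup>+ y. \<integral>\<^sup>+ z. \<integral>\<^sup>+ z'. indicator A (z, z', y)
       \<partial>distr (\<kappa> y) borel Z_path \<partial>distr (\<kappa> y) borel Z_path \<partial>distr P borel Y_path)"
proof -
  have \<kappa>': "\<kappa> \<in> borel \<rightarrow>\<^sub>M subprob_algebra borel"
    using measurable_prob_algebraD[OF \<kappa>] P(2) subprob_algebra_cong[of P borel] by metis
  define D where "D y = distr (\<kappa> y) borel Z_path" for y
  have D [measurable]: "D \<in> borel \<rightarrow>\<^sub>M subprob_algebra borel"
    unfolding D_def using measurable_compose[OF \<kappa>' measurable_distr[OF measurable_Z_path]] by simp
  have sets_D [simp]: "sets (D y) = sets borel" "space (D y) = UNIV" for y
    by (simp_all add: D_def)
  define R where "R y z z' = return borel (z, z', y)"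
    for y :: "int \<Rightarrow> 'f" and z z' :: "int \<Rightarrow> 'g"
  have R: "case_prod (\<lambda>y. case_prod (R y)) \<in> borel \<Otimes>\<^sub>M borel \<Otimes>\<^sub>M borel \<rightarrow>\<^sub>M subprob_algebra borel"
    unfolding R_def borel_prod[symmetric] by measurable
  have R1 [measurable]: "(\<lambda>x. R (f x) (g x) (h x)) \<in> M \<rightarrow>\<^sub>M subprob_algebra borel"
    if "f \<in> M \<rightarrow>\<^sub>M borel" "g \<in> M \<rightarrow>\<^sub>M borel" "h \<in> M \<rightarrow>\<^sub>M borel" for f g h and M :: "'c measure"
    using measurable_compose[OF measurable_Pair[OF that(1) measurable_Pair[OF that(2,3)]] R] by simp
  have "D y \<in> space (subprob_algebra borel)" for y
    using measurable_space[OF D] by simp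
  then have "(\<lambda>_. D y) \<in> M \<rightarrow>\<^sub>M subprob_algebra borel" for y and M :: "'c measure"
    by simp
  then have inner: "(\<lambda>z. D y \<bind> (\<lambda>z'. R y z z')) \<in> D y \<rightarrow>\<^sub>M subprob_algebra borel" for y
    by (rule measurable_bind) measurable
  have outer: "(\<lambda>y. D y \<bind> (\<lambda>z. D y \<bind> (\<lambda>z'. R y z z'))) \<in> borel \<rightarrow>\<^sub>M subprob_algebra borel"
    by (intro measurable_bind[where N = borel] measurable_compose[OF _ D]) measurable
  have "coupling P \<kappa> = distr P borel Y_path \<bind> (\<lambda>y. D y \<bind> (\<lambda>z. D y \<bind> (\<lambda>z'. R y z z')))"
    by (simp add: coupling_def D_def R_def)
  then show ?thesis
    using A outer inner
    by (simp add: emeasure_bind[where N = borel] R_def D_def[symmetric])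
qed

end

theory Submission
  imports Defs
begin

text \<open>
  Write \<open>x = (y, z\<^sub>-)\<close> for the information available at time \<open>0\<close> and \<open>K x\<close> for the conditional law of the
  whole path given \<open>x\<close>. Everything is controlled by the single number
  \<open>\<beta> (x, x') = \<parallel>K x - K x'\<parallel>\<close>, the total variation distance on the tail field \<open>\<A>\<^sup>Z\<close>: for
  almost every pair of pasts, each of the three conditions is equivalent to \<open>\<beta> (x, x') = 0\<close>.

  \<^item> Along a decreasing sequence of sigma-fields the total variation distance decreases to the
    distance on the intersection, and on every sigma-field the supremum is attained
    (\<open>tv_on_decseq\<close>). So the first condition says \<open>\<beta> = 0\<close> and the third one \<open>\<beta> < 2\<close>, for
    each pair of pasts separately. The second condition also forces \<open>\<beta> = 0\<close>.

  \<^item> The information process \<open>x\<close> is a Markov chain under \<open>P\<close>. Two copies that share the environment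
    \<open>y\<close> and move independently otherwise form a Markov chain of pairs, and the coupling of the theorem
    is, seen through the pasts, an invariant law of that chain (\<open>pair_law_invariant\<close>). This is
    where stationarity enters.

  \<^item> Averaging over later information can only decrease distances, so \<open>\<beta>\<close> is bounded by its mean after
    \<open>n\<close> steps of the pair chain. A bounded function with this property is, under an
    invariant law, constant along the chain: the mean of its square does not change
    (\<open>subharmonic_constant\<close>). Hence \<open>\<beta>\<close> after \<open>n\<close> steps almost surely equals \<open>\<beta> (x, x')\<close>.

  \<^item> Take a tail event \<open>A\<close> with \<open>2 (K x A - K x' A) = \<beta> (x, x')\<close>. Given the information at time \<open>n\<close>, the
    difference of the two conditional probabilities of \<open>A\<close> is at most \<open>\<beta> (x, x') / 2\<close> and has this
    number as its mean, so it is constant. As the two copies are independent, both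
    conditional probabilities are constant. Thus \<open>A\<close> is independent of the information up to each time
    \<open>n\<close>, hence of itself, and \<open>K x A\<close> and \<open>K x' A\<close> are \<open>0\<close> or \<open>1\<close> (\<open>zero_one_of_extremal\<close>).

  The last point gives the conclusion twice over. For an optimal \<open>A\<close> it gives \<open>\<beta> \<in> {0, 2}\<close>, so that
  \<open>\<beta> < 2\<close> already means \<open>\<beta> = 0\<close>. If \<open>\<beta> = 0\<close>, then every tail event is optimal, and the
  zero-one law of the second condition holds for all tail events at once, although the tail field
  need not be countably generated.
\<close>

section \<open>Total variation along a decreasing sequence of sigma-fields\<close>

lemma tv_on_bdd:
  assumes "prob_space \<mu>" "prob_space \<nu>"
  shows "bdd_above ((\<lambda>A. \<bar>measure \<mu> A - measure \<nu> A\<bar>) ` \<G>)"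
proof -
  interpret M: prob_space \<mu> by fact
  interpret N: prob_space \<nu> by fact
  have "\<bar>measure \<mu> A - measure \<nu> A\<bar> \<le> 1" for A
    using M.prob_le_1[of A] N.prob_le_1[of A] measure_nonneg[of \<mu> A] measure_nonneg[of \<nu> A]
    by linarith
  then show ?thesis
    by (rule bdd_aboveI2)
qed

lemma tv_on_upper:
  assumes "prob_space \<mu>" "prob_space \<nu>" "A \<in> \<G>"
  shows "2 * \<bar>measure \<mu> A - measure \<nu> A\<bar> \<le> tv_on \<G> \<mu> \<nu>"
  unfolding tv_on_def using cSUP_upper[OF assms(3) tv_on_bdd[OF assms(1,2)]] by simp

lemma tv_on_least:
  assumes "\<G> \<noteq> {}" "\<And>A. A \<in> \<G> \<Longrightarrow> 2 * \<bar>measure \<mu> A - measure \<nu> A\<bar> \<le> c"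
  shows "tv_on \<G> \<mu> \<nu> \<le> c"
proof -
  have "(SUP A\<in>\<G>. \<bar>measure \<mu> A - measure \<nu> A\<bar>) \<le> c / 2"
    by (rule cSUP_least[OF assms(1)]) (use assms(2) in force)
  then show ?thesis unfolding tv_on_def by simp
qed

lemma tv_on_bounds:
  assumes "prob_space \<mu>" "prob_space \<nu>" "\<G> \<noteq> {}"
  shows "0 \<le> tv_on \<G> \<mu> \<nu>" "tv_on \<G> \<mu> \<nu> \<le> 2"
proof -
  obtain A where "A \<in> \<G>" using assms(3) by blast
  from tv_on_upper[OF assms(1,2) this] show "0 \<le> tv_on \<G> \<mu> \<nu>"
    by (rule order_trans[rotated]) simp
  interpret M: prob_space \<mu> by fact
  interpret N: prob_space \<nu> by fact
  have "\<bar>measure \<mu> A - measure \<nu> A\<bar> \<le> 1" for A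
    using M.prob_le_1[of A] N.prob_le_1[of A] measure_nonneg[of \<mu> A] measure_nonneg[of \<nu> A]
    by linarith
  then show "tv_on \<G> \<mu> \<nu> \<le> 2" by (intro tv_on_least assms) auto
qed

lemma tv_on_mono:
  assumes "prob_space \<mu>" "prob_space \<nu>" "\<G> \<subseteq> \<H>" "\<G> \<noteq> {}"
  shows "tv_on \<G> \<mu> \<nu> \<le> tv_on \<H> \<mu> \<nu>"
  using assms by (intro tv_on_least tv_on_upper) auto

text \<open>
  A near-optimal set \<open>D\<^sub>k\<close> for the difference \<open>\<sigma>\<close> of the measures is chosen at a time so late that the
  optimal value there exceeds its limit \<open>c\<close> by at most \<open>2\<^sup>-\<^sup>k\<close>. By modularity of \<open>\<sigma>\<close>, joining further sets to
  \<open>D\<^sub>k\<close> loses only a geometrically small amount, since the intersection that is lost lies in the field of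
  the earlier time. So the limit superior of these sets, a tail set, still has \<open>\<sigma> \<ge> c\<close>.
\<close>

lemma near_optimal_set_in_tail:
  fixes \<G> :: "nat \<Rightarrow> 'w set set"
  assumes sa: "\<And>n. sigma_algebra UNIV (\<G> n)" and dec: "decseq \<G>"
    and "finite_measure \<mu>" "finite_measure \<nu>"
    and sub: "\<G> 0 \<subseteq> sets \<mu>" "\<G> 0 \<subseteq> sets \<nu>"
  obtains D where "D \<in> (\<Inter>n. \<G> n)"
    and "\<And>e. e > 0 \<Longrightarrow> \<exists>n. \<forall>A\<in>\<G> n. measure \<mu> A - measure \<nu> A \<le> measure \<mu> D - measure \<nu> D + e"
proof -
  interpret M: finite_measure \<mu> by fact
  interpret N: finite_measure \<nu> by fact
  interpret G: sigma_algebra UNIV "\<G> n" for n by (rule sa)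
  define \<sigma> where "\<sigma> A = measure \<mu> A - measure \<nu> A" for A
  define s where "s n = (SUP A\<in>\<G> n. \<sigma> A)" for n
  define c where "c = (INF n. s n)"
  have sets: "A \<in> sets \<mu>" "A \<in> sets \<nu>" if "A \<in> \<G> n" for A n
    using sub decseqD[OF dec, of 0 n] that by auto
  have bdd: "bdd_above (\<sigma> ` \<G> n)" for n
  proof (rule bdd_aboveI2)
    show "\<sigma> A \<le> measure \<mu> (space \<mu>)" for A
      unfolding \<sigma>_def using M.bounded_measure[of A] measure_nonneg[of \<nu> A] by linarith
  qed
  have s_upper: "\<sigma> A \<le> s n" if "A \<in> \<G> n" for A n
    unfolding s_def using that bdd by (rule cSUP_upper)
  have s_nonneg: "0 \<le> s n" for n
    using s_upper[of "{}" n] by (simp add: \<sigma>_def)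
  have c_le: "c \<le> s n" for n
    unfolding c_def using s_nonneg by (intro cINF_lower) (auto intro: bdd_belowI2[where m=0])
  have s_mono: "s m \<le> s n" if "n \<le> m" for m n
    unfolding s_def using decseqD[OF dec that] bdd[of n] G.empty_sets
    by (intro cSUP_subset_mono) auto
  have "\<exists>n. s n < c + (1/2)^k" for k :: nat
    using cInf_lessD[of "range s" "c + (1/2)^k"] by (auto simp: c_def)
  then obtain N0 where N0: "s (N0 k) < c + (1/2)^k" for k :: nat by metis
  \<comment> \<open>Partial sums turn the thresholds into an increasing sequence that exceeds every time.\<close>
  define N where "N k = k + (\<Sum>i\<le>k. N0 i)" for k
  have N_mono: "N i \<le> N j" if "i \<le> j" for i j
    unfolding N_def using that by (intro add_mono sum_mono2) auto
  have N_ge: "k \<le> N k" "N0 k \<le> N k" for k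
    unfolding N_def using member_le_sum[of k "{..k}" N0] by auto
  have N: "s (N k) \<le> c + (1/2)^k" for k
    using s_mono[OF N_ge(2)] N0[of k] by (meson less_eq_real_def order_trans)
  have "\<exists>D\<in>\<G> (N k). c - (1/2)^k \<le> \<sigma> D" for k
  proof -
    have "s (N k) - (1/2)^k < (SUP A\<in>\<G> (N k). \<sigma> A)" unfolding s_def by simp
    from less_cSupD[OF _ this] G.empty_sets obtain D where "D \<in> \<G> (N k)" "s (N k) - (1/2)^k < \<sigma> D"
      by auto
    with c_le[of "N k"] show ?thesis by (intro bexI[of _ D]) auto
  qed
  then obtain D where D: "D k \<in> \<G> (N k)" "c - (1/2)^k \<le> \<sigma> (D k)" for k by metis
  have D_in: "D i \<in> \<G> (N j)" if "j \<le> i" for i j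
    using D(1)[of i] decseqD[OF dec N_mono[OF that]] by auto
  have U_in: "(\<Union>i\<le>m. D (j + i)) \<in> \<G> (N j)" for j m
    using D_in by (intro G.finite_UN) auto
  have modular: "\<sigma> (A \<union> B) = \<sigma> A + \<sigma> B - \<sigma> (A \<inter> B)" if "A \<in> \<G> n" "B \<in> \<G> n" for A B n
  proof -
    have "measure \<mu> (A \<union> B) = measure \<mu> A + measure \<mu> B - measure \<mu> (A \<inter> B)"
      using sets[OF that(1)] sets[OF that(2)]
      by (simp add: M.finite_measure_Union' M.finite_measure_Diff' Int_commute)
    moreover have "measure \<nu> (A \<union> B) = measure \<nu> A + measure \<nu> B - measure \<nu> (A \<inter> B)"
      using sets[OF that(1)] sets[OF that(2)]
      by (simp add: N.finite_measure_Union' N.finite_measure_Diff' Int_commute)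
    ultimately show ?thesis by (simp add: \<sigma>_def)
  qed
  \<comment> \<open>Joining \<open>D j\<close> to the later sets costs \<open>2 * (1/2)^j\<close>: half for the near-optimality of \<open>D j\<close>, half for the
    intersection. These costs add up to \<open>4 * (1/2)^j\<close>.\<close>
  have U: "c - 4 * (1/2)^j \<le> \<sigma> (\<Union>i\<le>m. D (j + i))" for j m
  proof (induction m arbitrary: j)
    case 0
    have "0 \<le> (1/2::real)^j" by simp
    then have "c - 4 * (1/2)^j \<le> c - (1/2)^j" by linarith
    also have "\<dots> \<le> \<sigma> (D j)" by (rule D(2))
    finally show ?case by simp
  next
    case (Suc m)
    let ?V = "\<Union>i\<le>m. D (Suc j + i)"
    have eq: "(\<Union>i\<le>Suc m. D (j + i)) = D j \<union> ?V"
      unfolding atMost_Suc_eq_insert_0 by (simp add: image_image)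
    have V: "?V \<in> \<G> (N j)"
      using U_in[of "Suc j" m] decseqD[OF dec N_mono[of j "Suc j"]] by auto
    have "\<sigma> (D j \<inter> ?V) \<le> c + (1/2)^j"
      using s_upper[OF G.Int[OF D(1) V]] N[of j] by linarith
    with Suc.IH[of "Suc j"] D(2)[of j] show ?case
      unfolding eq modular[OF D(1) V] by simp
  qed
  define V where "V j = (\<Union>i. D (j + i))" for j
  have V_in: "V j \<in> \<G> (N j)" for j
    unfolding V_def using D_in by (intro G.countable_UN) auto
  have V: "c - 4 * (1/2)^j \<le> \<sigma> (V j)" for j
  proof (rule LIMSEQ_le_const)
    have *: "(\<Union>m. \<Union>i\<le>m. D (j + i)) = V j" by (auto simp: V_def)
    have inc: "incseq (\<lambda>m. \<Union>i\<le>m. D (j + i))" by (rule incseq_SucI) (auto simp: atMost_Suc)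
    have "(\<lambda>m. measure \<mu> (\<Union>i\<le>m. D (j + i))) \<longlonglongrightarrow> measure \<mu> (V j)"
      "(\<lambda>m. measure \<nu> (\<Union>i\<le>m. D (j + i))) \<longlonglongrightarrow> measure \<nu> (V j)"
      using M.finite_Lim_measure_incseq[OF _ inc] N.finite_Lim_measure_incseq[OF _ inc] sets[OF U_in]
      unfolding * by (auto simp: image_subset_iff)
    then show "(\<lambda>m. \<sigma> (\<Union>i\<le>m. D (j + i))) \<longlonglongrightarrow> \<sigma> (V j)"
      unfolding \<sigma>_def by (rule tendsto_diff)
    show "\<exists>m0. \<forall>m\<ge>m0. c - 4 * (1/2)^j \<le> \<sigma> (\<Union>i\<le>m. D (j + i))"
      using U by blast
  qed
  define W where "W = (\<Inter>j. V j)"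
  have V_dec: "decseq V"
  proof (rule decseq_SucI)
    show "V (Suc j) \<subseteq> V j" for j
      unfolding V_def by (auto simp flip: add_Suc_right)
  qed
  have "W \<in> \<G> n" for n
  proof -
    have "W = (\<Inter>j. V (n + j))"
      unfolding W_def using decseqD[OF V_dec] by (auto simp: subset_eq) (meson le_add2)
    moreover have "V (n + j) \<in> \<G> n" for j
      using V_in[of "n + j"] decseqD[OF dec, of n "N (n + j)"] N_ge(1)[of "n + j"] by auto
    ultimately show ?thesis by auto
  qed
  then have W_in: "W \<in> (\<Inter>n. \<G> n)" by blast
  have "c \<le> \<sigma> W"
  proof (rule LIMSEQ_le)
    have "(\<lambda>j. measure \<mu> (V j)) \<longlonglongrightarrow> measure \<mu> W" "(\<lambda>j. measure \<nu> (V j)) \<longlonglongrightarrow> measure \<nu> W"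
      unfolding W_def
      using M.finite_Lim_measure_decseq[OF _ V_dec] N.finite_Lim_measure_decseq[OF _ V_dec] sets[OF V_in]
      by (auto simp: image_subset_iff)
    then show "(\<lambda>j. \<sigma> (V j)) \<longlonglongrightarrow> \<sigma> W"
      unfolding \<sigma>_def by (rule tendsto_diff)
    have "(\<lambda>j. c - 4 * (1/2)^j) \<longlonglongrightarrow> c - 4 * 0"
      by (intro tendsto_intros LIMSEQ_realpow_zero) auto
    then show "(\<lambda>j. c - 4 * (1/2)^j) \<longlonglongrightarrow> c" by simp
  qed (use V in auto)
  show ?thesis
  proof (rule that[OF W_in])
    fix e :: real assume "e > 0"
    then obtain n where "s n < c + e"
      using cInf_lessD[of "range s" "c + e"] by (auto simp: c_def)
    with s_upper \<open>c \<le> \<sigma> W\<close> show "\<exists>n. \<forall>A\<in>\<G> n. measure \<mu> A - measure \<nu> A \<le> measure \<mu> W - measure \<nu> W + e"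
      unfolding \<sigma>_def by (intro exI[of _ n]) force
  qed
qed

text \<open>
  For probability measures, passing to complements removes the absolute value in the distance, so
  the set of the preceding lemma is optimal.
\<close>

lemma tv_on_decseq:
  fixes \<G> :: "nat \<Rightarrow> 'w set set"
  assumes sa: "\<And>n. sigma_algebra UNIV (\<G> n)" and dec: "decseq \<G>"
    and \<mu>: "prob_space \<mu>" "space \<mu> = UNIV" "\<G> 0 \<subseteq> sets \<mu>"
    and \<nu>: "prob_space \<nu>" "space \<nu> = UNIV" "\<G> 0 \<subseteq> sets \<nu>"
  shows "\<exists>D\<in>(\<Inter>n. \<G> n). 2 * (measure \<mu> D - measure \<nu> D) = tv_on (\<Inter>n. \<G> n) \<mu> \<nu>"
    and "(\<lambda>n. tv_on (\<G> n) \<mu> \<nu>) \<longlonglongrightarrow> tv_on (\<Inter>n. \<G> n) \<mu> \<nu>"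
proof -
  interpret M: prob_space \<mu> by fact
  interpret N: prob_space \<nu> by fact
  interpret G: sigma_algebra UNIV "\<G> n" for n by (rule sa)
  obtain D where D: "D \<in> (\<Inter>n. \<G> n)"
    and opt: "\<And>e. e > 0 \<Longrightarrow> \<exists>n. \<forall>A\<in>\<G> n. measure \<mu> A - measure \<nu> A \<le> measure \<mu> D - measure \<nu> D + e"
    using near_optimal_set_in_tail[OF sa dec] M.finite_measure_axioms N.finite_measure_axioms \<mu>(3) \<nu>(3)
    by metis
  define t where "t = 2 * (measure \<mu> D - measure \<nu> D)"
  have tail_le: "tv_on (\<Inter>n. \<G> n) \<mu> \<nu> \<le> tv_on (\<G> n) \<mu> \<nu>" for n
    using D by (intro tv_on_mono \<mu> \<nu>) auto
  have t_le: "t \<le> tv_on (\<Inter>n. \<G> n) \<mu> \<nu>"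
    using tv_on_upper[OF \<mu>(1) \<nu>(1) D] abs_ge_self[of "measure \<mu> D - measure \<nu> D"]
    unfolding t_def by (smt (verit))
  have near: "\<exists>n0. \<forall>n\<ge>n0. tv_on (\<G> n) \<mu> \<nu> \<le> t + e" if "e > 0" for e
  proof -
    obtain n0 where n0: "\<And>A. A \<in> \<G> n0 \<Longrightarrow> measure \<mu> A - measure \<nu> A \<le> measure \<mu> D - measure \<nu> D + e / 2"
      using opt[of "e / 2"] \<open>e > 0\<close> by auto
    have "tv_on (\<G> n) \<mu> \<nu> \<le> t + e" if "n \<ge> n0" for n
    proof (rule tv_on_least)
      show "\<G> n \<noteq> {}" using G.empty_sets by blast
      fix A assume "A \<in> \<G> n"
      then have A: "A \<in> \<G> n0" using decseqD[OF dec that] by blast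
      moreover from this have "- A \<in> \<G> n0" using G.compl_sets[of A n0] by (simp add: Compl_eq_Diff_UNIV)
      moreover have "A \<in> sets \<mu>" "A \<in> sets \<nu>"
        using A \<mu>(3) \<nu>(3) decseqD[OF dec, of 0 n0] by auto
      then have "measure \<mu> (- A) = 1 - measure \<mu> A" "measure \<nu> (- A) = 1 - measure \<nu> A"
        using M.prob_compl[of A] N.prob_compl[of A] \<mu>(2) \<nu>(2) by (auto simp: Compl_eq_Diff_UNIV)
      ultimately have "\<bar>measure \<mu> A - measure \<nu> A\<bar> \<le> measure \<mu> D - measure \<nu> D + e / 2"
        using n0[of A] n0[of "- A"] by (intro abs_leI) auto
      then show "2 * \<bar>measure \<mu> A - measure \<nu> A\<bar> \<le> t + e"
        unfolding t_def by (simp add: field_simps)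
    qed
    then show ?thesis by blast
  qed
  have eq: "tv_on (\<Inter>n. \<G> n) \<mu> \<nu> = t"
  proof (rule antisym[OF _ t_le], rule field_le_epsilon)
    fix e :: real assume "e > 0"
    then show "tv_on (\<Inter>n. \<G> n) \<mu> \<nu> \<le> t + e"
      using near tail_le order_trans by blast
  qed
  then show "\<exists>D\<in>(\<Inter>n. \<G> n). 2 * (measure \<mu> D - measure \<nu> D) = tv_on (\<Inter>n. \<G> n) \<mu> \<nu>"
    using D t_def by metis
  show "(\<lambda>n. tv_on (\<G> n) \<mu> \<nu>) \<longlonglongrightarrow> tv_on (\<Inter>n. \<G> n) \<mu> \<nu>"
  proof (rule LIMSEQ_I)
    fix e :: real assume "e > 0"
    then obtain n0 where "\<And>n. n \<ge> n0 \<Longrightarrow> tv_on (\<G> n) \<mu> \<nu> \<le> t + e / 2"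
      using near[of "e / 2"] by auto
    then show "\<exists>n0. \<forall>n\<ge>n0. norm (tv_on (\<G> n) \<mu> \<nu> - tv_on (\<Inter>n. \<G> n) \<mu> \<nu>) < e"
      using tail_le \<open>e > 0\<close> unfolding eq real_norm_def
      by (intro exI[of _ n0]) (smt (verit) field_sum_of_halves)
  qed
qed

text \<open>
  The supremum is attained, which is the case of a constant sequence in \<open>tv_on_decseq\<close>; a set with
  difference \<open>1\<close> separates the measures.
\<close>

lemma tv_on_less_2_iff_not_singular:
  assumes "sigma_algebra UNIV \<G>"
    and \<mu>: "prob_space \<mu>" "space \<mu> = UNIV" "\<G> \<subseteq> sets \<mu>"
    and \<nu>: "prob_space \<nu>" "space \<nu> = UNIV" "\<G> \<subseteq> sets \<nu>"
  shows "tv_on \<G> \<mu> \<nu> < 2 \<longleftrightarrow> \<not> mutually_singular_on \<G> \<mu> \<nu>"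
proof -
  interpret M: prob_space \<mu> by fact
  interpret N: prob_space \<nu> by fact
  interpret G: sigma_algebra UNIV \<G> by fact
  have compl: "- A \<in> \<G>" if "A \<in> \<G>" for A
    using G.compl_sets[OF that] by (simp add: Compl_eq_Diff_UNIV)
  have nu_compl: "measure \<nu> (- A) = 1 - measure \<nu> A" if "A \<in> \<G>" for A
    using N.prob_compl[of A] \<nu> that by (auto simp: Compl_eq_Diff_UNIV)
  have mu_compl: "measure \<mu> (- A) = 1 - measure \<mu> A" if "A \<in> \<G>" for A
    using M.prob_compl[of A] \<mu> that by (auto simp: Compl_eq_Diff_UNIV)
  have le_2: "tv_on \<G> \<mu> \<nu> \<le> 2"
    using G.empty_sets by (intro tv_on_bounds \<mu> \<nu>) auto
  show ?thesis
  proof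
    assume less: "tv_on \<G> \<mu> \<nu> < 2"
    show "\<not> mutually_singular_on \<G> \<mu> \<nu>"
    proof
      assume "mutually_singular_on \<G> \<mu> \<nu>"
      then obtain A where A: "A \<in> \<G>" "measure \<mu> A = 0" "measure \<nu> (- A) = 0"
        by (auto simp: mutually_singular_on_def)
      with nu_compl[of A] tv_on_upper[OF \<mu>(1) \<nu>(1) A(1)] less show False by auto
    qed
  next
    assume ns: "\<not> mutually_singular_on \<G> \<mu> \<nu>"
    show "tv_on \<G> \<mu> \<nu> < 2"
    proof (rule ccontr)
      assume "\<not> tv_on \<G> \<mu> \<nu> < 2"
      with le_2 have "tv_on \<G> \<mu> \<nu> = 2" by simp
      then obtain D where D: "D \<in> \<G>" "measure \<mu> D - measure \<nu> D = 1"
        using tv_on_decseq(1)[of "\<lambda>_. \<G>" \<mu> \<nu>] assms by (auto simp: decseq_def)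
      have "measure \<mu> D = 1" "measure \<nu> D = 0"
        using D(2) M.prob_le_1[of D] measure_nonneg[of \<nu> D] by linarith+
      then have "measure \<mu> (- D) = 0 \<and> measure \<nu> (- (- D)) = 0"
        using mu_compl[OF D(1)] by simp
      with ns compl[OF D(1)] show False by (auto simp: mutually_singular_on_def)
    qed
  qed
qed

section \<open>Measurability of the total variation distance between kernels\<close>

text \<open>
  Outer regularity approximates a Borel set by open sets, and open sets are increasing limits of
  finite unions of basic ones. What matters is that the countable family does not depend on the
  measures.
\<close>

lemma countable_uniform_approximation:
  obtains \<C> :: "'b::polish_space set set"
  where "countable \<C>" "{} \<in> \<C>" "\<C> \<subseteq> sets borel"
    and "\<And>\<mu> \<nu> A e. finite_measure \<mu> \<Longrightarrow> finite_measure \<nu> \<Longrightarrow> sets \<mu> = sets borel \<Longrightarrow> sets \<nu> = sets borel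
      \<Longrightarrow> A \<in> sets borel \<Longrightarrow> e > 0
      \<Longrightarrow> \<exists>C\<in>\<C>. \<bar>measure \<mu> A - measure \<mu> C\<bar> < e \<and> \<bar>measure \<nu> A - measure \<nu> C\<bar> < e"
proof -
  obtain \<B> :: "'b set set" where \<B>: "countable \<B>" "topological_basis \<B>"
    using ex_countable_basis by blast
  define \<C> where "\<C> = Union ` {F. finite F \<and> F \<subseteq> \<B>}"
  have open_\<C>: "open C" if "C \<in> \<C>" for C
    using that topological_basis_open[OF \<B>(2)] by (auto simp: \<C>_def)
  have outer: "\<exists>U. open U \<and> A \<subseteq> U \<and> measure \<mu> U < measure \<mu> A + e"
    if "finite_measure \<mu>" "sets \<mu> = sets borel" "A \<in> sets borel" "e > 0" for \<mu> and A :: "'b set" and e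
  proof -
    interpret finite_measure \<mu> by fact
    have "emeasure \<mu> A < ennreal (measure \<mu> A + e)"
      using \<open>e > 0\<close> by (simp add: emeasure_eq_measure ennreal_less_iff)
    then have "(INF U\<in>{U. A \<subseteq> U \<and> open U}. emeasure \<mu> U) < ennreal (measure \<mu> A + e)"
      using outer_regular[OF that(2) _ that(3)] emeasure_finite by simp
    then obtain U where "A \<subseteq> U" "open U" "emeasure \<mu> U < ennreal (measure \<mu> A + e)"
      by (auto simp: INF_less_iff)
    then show ?thesis by (auto simp: emeasure_eq_measure ennreal_less_iff intro!: exI[of _ U])
  qed
  show ?thesis
  proof (rule that)
    show "countable \<C>"
      unfolding \<C>_def using countable_Collect_finite_subset[OF \<B>(1)] by (intro countable_image) auto
    show "{} \<in> \<C>" by (auto simp: \<C>_def intro!: image_eqI[of _ _ "{}"])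
    show "\<C> \<subseteq> sets borel" using open_\<C> by auto
    fix \<mu> \<nu> :: "'b measure" and A :: "'b set" and e :: real
    assume "finite_measure \<mu>" "finite_measure \<nu>" and [simp]: "sets \<mu> = sets borel" "sets \<nu> = sets borel"
      and [measurable]: "A \<in> sets borel" and "e > 0"
    interpret M: finite_measure \<mu> by fact
    interpret N: finite_measure \<nu> by fact
    obtain U1 where U1: "open U1" "A \<subseteq> U1" "measure \<mu> U1 < measure \<mu> A + e / 2"
      using outer[of \<mu> A "e / 2"] M.finite_measure_axioms \<open>e > 0\<close> by auto
    obtain U2 where U2: "open U2" "A \<subseteq> U2" "measure \<nu> U2 < measure \<nu> A + e / 2"
      using outer[of \<nu> A "e / 2"] N.finite_measure_axioms \<open>e > 0\<close> by auto
    define U where "U = U1 \<inter> U2"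
    have "open U" using U1 U2 by (auto simp: U_def)
    then have [measurable]: "U \<in> sets borel" by simp
    have "measure \<mu> U \<le> measure \<mu> U1" "measure \<mu> A \<le> measure \<mu> U"
      "measure \<nu> U \<le> measure \<nu> U2" "measure \<nu> A \<le> measure \<nu> U"
      using U1 U2 \<open>U \<in> sets borel\<close> by (auto intro!: M.finite_measure_mono N.finite_measure_mono simp: U_def)
    then have AU: "\<bar>measure \<mu> A - measure \<mu> U\<bar> < e / 2" "\<bar>measure \<nu> A - measure \<nu> U\<bar> < e / 2"
      using U1(3) U2(3) by linarith+
    obtain B' where B': "B' \<subseteq> \<B>" "\<Union>B' = U"
      using \<B>(2) \<open>open U\<close> unfolding topological_basis_def by blast
    show "\<exists>C\<in>\<C>. \<bar>measure \<mu> A - measure \<mu> C\<bar> < e \<and> \<bar>measure \<nu> A - measure \<nu> C\<bar> < e"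
    proof (cases "B' = {}")
      case True
      then have "U = {}" using B' by auto
      with AU \<open>{} \<in> \<C>\<close> \<open>e > 0\<close> show ?thesis by (intro bexI[of _ "{}"]) auto
    next
      case False
      have "countable B'" using B'(1) \<B>(1) countable_subset by blast
      define C where "C k = (\<Union>i\<le>k. from_nat_into B' i)" for k
      have C: "C k \<in> \<C>" for k
        unfolding C_def \<C>_def using from_nat_into[OF False] B'(1)
        by (intro imageI CollectI) auto
      have inc: "incseq C" unfolding C_def by (rule incseq_SucI) (auto simp: atMost_Suc)
      have "(\<Union>k. C k) = \<Union>(range (from_nat_into B'))" unfolding C_def by auto
      then have UC: "(\<Union>k. C k) = U"
        using range_from_nat_into[OF False \<open>countable B'\<close>] B'(2) by simp
      have "range C \<subseteq> sets borel" using C open_\<C> by auto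
      then have "(\<lambda>k. measure \<mu> (C k)) \<longlonglongrightarrow> measure \<mu> U" "(\<lambda>k. measure \<nu> (C k)) \<longlonglongrightarrow> measure \<nu> U"
        using M.finite_Lim_measure_incseq[OF _ inc] N.finite_Lim_measure_incseq[OF _ inc] UC by auto
      moreover have "\<forall>\<^sub>F k in sequentially. \<bar>f k - l\<bar> < e / 2" if "f \<longlonglongrightarrow> l" for f and l :: real
        using tendstoD[OF that, of "e / 2"] \<open>e > 0\<close> by (simp add: dist_real_def)
      ultimately have "\<forall>\<^sub>F k in sequentially. \<bar>measure \<mu> (C k) - measure \<mu> U\<bar> < e / 2 \<and>
          \<bar>measure \<nu> (C k) - measure \<nu> U\<bar> < e / 2"
        by (intro eventually_conj)
      then obtain k where k: "\<bar>measure \<mu> (C k) - measure \<mu> U\<bar> < e / 2" "\<bar>measure \<nu> (C k) - measure \<nu> U\<bar> < e / 2"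
        using eventually_happens[of _ sequentially] by auto
      from AU k C show ?thesis by (intro bexI[of _ "C k"]) linarith+
    qed
  qed
qed

text \<open>
  The supremum over a countably generated field is a supremum over a countable family that works for
  all pairs of measures, so the distance between two kernels is a measurable function.
\<close>

lemma measurable_tv_on_vimage:
  fixes W :: "'w::topological_space \<Rightarrow> 'b::polish_space"
  assumes W [measurable]: "W \<in> borel \<rightarrow>\<^sub>M borel"
    and \<kappa>: "\<kappa> \<in> M \<rightarrow>\<^sub>M prob_algebra borel" "\<kappa>' \<in> M \<rightarrow>\<^sub>M prob_algebra borel"
  shows "(\<lambda>x. tv_on {W -` B | B. B \<in> sets borel} (\<kappa> x) (\<kappa>' x)) \<in> borel_measurable M"
proof -
  obtain \<C> :: "'b set set" where \<C>: "countable \<C>" "{} \<in> \<C>" "\<C> \<subseteq> sets borel"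
    and approx: "\<And>\<mu> \<nu> A e. finite_measure \<mu> \<Longrightarrow> finite_measure \<nu> \<Longrightarrow> sets \<mu> = sets borel \<Longrightarrow> sets \<nu> = sets borel
      \<Longrightarrow> A \<in> sets borel \<Longrightarrow> e > 0
      \<Longrightarrow> \<exists>C\<in>\<C>. \<bar>measure \<mu> A - measure \<mu> C\<bar> < e \<and> \<bar>measure \<nu> A - measure \<nu> C\<bar> < e"
    by (rule countable_uniform_approximation) blast
  define \<W> where "\<W> = (\<lambda>C. W -` C) ` \<C>"
  have \<W>_sets: "A \<in> sets borel" if "A \<in> \<W>" for A
    using that \<C>(3) measurable_sets[OF W] by (auto simp: \<W>_def)
  have eq: "tv_on {W -` B | B. B \<in> sets borel} (\<kappa> x) (\<kappa>' x) = tv_on \<W> (\<kappa> x) (\<kappa>' x)" if "x \<in> space M" for x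
  proof (rule antisym)
    have p: "prob_space (\<kappa> x)" "sets (\<kappa> x) = sets borel"
      and p': "prob_space (\<kappa>' x)" "sets (\<kappa>' x) = sets borel"
      using measurable_space[OF \<kappa>(1) that] measurable_space[OF \<kappa>(2) that] by (auto simp: space_prob_algebra)
    have sp: "space (\<kappa> x) = UNIV" "space (\<kappa>' x) = UNIV"
      using sets_eq_imp_space_eq[OF p(2)] sets_eq_imp_space_eq[OF p'(2)] by auto
    have W': "W \<in> \<kappa> x \<rightarrow>\<^sub>M borel" "W \<in> \<kappa>' x \<rightarrow>\<^sub>M borel"
      using W p p' by (simp_all cong: measurable_cong_sets)
    show "tv_on \<W> (\<kappa> x) (\<kappa>' x) \<le> tv_on {W -` B | B. B \<in> sets borel} (\<kappa> x) (\<kappa>' x)"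
      using \<C> by (intro tv_on_mono p p') (auto simp: \<W>_def)
    show "tv_on {W -` B | B. B \<in> sets borel} (\<kappa> x) (\<kappa>' x) \<le> tv_on \<W> (\<kappa> x) (\<kappa>' x)"
    proof (rule tv_on_least, blast)
      fix A assume "A \<in> {W -` B | B. B \<in> sets borel}"
      then obtain B where B: "A = W -` B" "B \<in> sets borel" by auto
      show "2 * \<bar>measure (\<kappa> x) A - measure (\<kappa>' x) A\<bar> \<le> tv_on \<W> (\<kappa> x) (\<kappa>' x)"
      proof (rule field_le_epsilon)
        fix e :: real assume "e > 0"
        interpret D: prob_space "distr (\<kappa> x) borel W"
          using p W' by (intro prob_space.prob_space_distr) auto
        interpret D': prob_space "distr (\<kappa>' x) borel W"
          using p' W' by (intro prob_space.prob_space_distr) auto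
        obtain C where C: "C \<in> \<C>" "\<bar>D.prob B - D.prob C\<bar> < e / 4" "\<bar>D'.prob B - D'.prob C\<bar> < e / 4"
          using approx[of "distr (\<kappa> x) borel W" "distr (\<kappa>' x) borel W" B "e / 4"] B \<open>e > 0\<close>
            D.finite_measure_axioms D'.finite_measure_axioms by auto
        have CB: "C \<in> sets borel" using C \<C> by auto
        have "\<bar>measure (\<kappa> x) A - measure (\<kappa> x) (W -` C)\<bar> < e / 4"
          "\<bar>measure (\<kappa>' x) A - measure (\<kappa>' x) (W -` C)\<bar> < e / 4"
          using C(2,3) B CB W' by (simp_all add: measure_distr sp)
        then have "\<bar>measure (\<kappa> x) A - measure (\<kappa>' x) A\<bar>
            \<le> \<bar>measure (\<kappa> x) (W -` C) - measure (\<kappa>' x) (W -` C)\<bar> + e / 2"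
          by linarith
        moreover have "2 * \<bar>measure (\<kappa> x) (W -` C) - measure (\<kappa>' x) (W -` C)\<bar> \<le> tv_on \<W> (\<kappa> x) (\<kappa>' x)"
          using C by (intro tv_on_upper p p') (auto simp: \<W>_def)
        ultimately show "2 * \<bar>measure (\<kappa> x) A - measure (\<kappa>' x) A\<bar> \<le> tv_on \<W> (\<kappa> x) (\<kappa>' x) + e"
          by (smt (verit) field_sum_of_halves)
      qed
    qed
  qed
  have "(\<lambda>x. tv_on \<W> (\<kappa> x) (\<kappa>' x)) \<in> borel_measurable M"
    unfolding tv_on_def
  proof (intro borel_measurable_times borel_measurable_const borel_measurable_cSUP)
    show "countable \<W>" using \<C> by (auto simp: \<W>_def)
    fix A assume "A \<in> \<W>"
    then have [measurable]: "A \<in> sets borel" by (rule \<W>_sets)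
    show "(\<lambda>x. \<bar>measure (\<kappa> x) A - measure (\<kappa>' x) A\<bar>) \<in> borel_measurable M"
      using measurable_compose[OF \<kappa>(1) measurable_measure_prob_algebra]
        measurable_compose[OF \<kappa>(2) measurable_measure_prob_algebra] by measurable
  next
    fix x assume "x \<in> space M"
    then show "bdd_above ((\<lambda>A. \<bar>measure (\<kappa> x) A - measure (\<kappa>' x) A\<bar>) ` \<W>)"
      using measurable_space[OF \<kappa>(1)] measurable_space[OF \<kappa>(2)]
      by (intro tv_on_bdd) (auto simp: space_prob_algebra)
  qed
  then show ?thesis by (subst measurable_cong[OF eq])
qed

section \<open>Subharmonic functions under an invariant law\<close>

text \<open>
  The variance argument behind \<open>L\<^sup>2\<close>-bounded martingales: expanding the square, the mean of
  \<open>(f u - f x)\<^sup>2\<close> over one step from \<open>x\<close> is at most \<open>T (f\<^sup>2) x - (f x)\<^sup>2\<close> because \<open>f \<le> T f\<close> and \<open>f \<ge> 0\<close>;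
  by invariance the latter has integral \<open>0\<close>.
\<close>

lemma (in prob_space) subharmonic_constant:
  fixes f :: "'a \<Rightarrow> real"
  assumes T [measurable]: "T \<in> M \<rightarrow>\<^sub>M prob_algebra M" and inv: "M \<bind> T = M"
    and f [measurable]: "f \<in> borel_measurable M" and bounds: "\<And>x. 0 \<le> f x" "\<And>x. f x \<le> c"
    and sub: "AE x in M. f x \<le> (\<integral>u. f u \<partial>T x)"
  shows "AE x in M. AE u in T x. f u = f x"
proof -
  have T': "T \<in> M \<rightarrow>\<^sub>M subprob_algebra M" using T by (rule measurable_prob_algebraD)
  have p: "prob_space (T x)" "sets (T x) = sets M" if "x \<in> space M" for x
    using measurable_space[OF T that] by (auto simp: space_prob_algebra)
  have sq: "(f x)\<^sup>2 \<le> c\<^sup>2" for x using bounds by (simp add: power_mono)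
  have fT: "f \<in> borel_measurable (T x)" if "x \<in> space M" for x
    using f p(2)[OF that] by (simp cong: measurable_cong_sets)
  have int: "integrable (T x) f" "integrable (T x) (\<lambda>u. (f u)\<^sup>2)" if "x \<in> space M" for x
  proof -
    interpret X: prob_space "T x" by (rule p) fact
    show "integrable (T x) f"
      using bounds fT[OF that] by (intro X.integrable_const_bound[of _ c]) auto
    show "integrable (T x) (\<lambda>u. (f u)\<^sup>2)"
      using sq fT[OF that] by (intro X.integrable_const_bound[of _ "c\<^sup>2"]) auto
  qed
  define g where "g x = (\<integral>u. (f u)\<^sup>2 \<partial>T x)" for x
  have g_m [measurable]: "g \<in> borel_measurable M"
    unfolding g_def using T' by (intro measurable_compose[OF T' integral_measurable_subprob_algebra]) measurable
  have g_bd: "0 \<le> g x" "g x \<le> c\<^sup>2" if "x \<in> space M" for x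
  proof -
    interpret X: prob_space "T x" by (rule p) fact
    show "0 \<le> g x" unfolding g_def by (intro integral_nonneg_AE) auto
    have "g x \<le> (\<integral>u. c\<^sup>2 \<partial>T x)"
      unfolding g_def using sq by (intro integral_mono int that) auto
    then show "g x \<le> c\<^sup>2" by (simp add: X.prob_space)
  qed
  have int_g: "integrable M g"
    using g_bd by (intro integrable_const_bound[of _ "c\<^sup>2"]) auto
  have int_f2: "integrable M (\<lambda>x. (f x)\<^sup>2)"
    using sq by (intro integrable_const_bound[of _ "c\<^sup>2"]) auto
  have "ennreal (\<integral>x. (f x)\<^sup>2 \<partial>M) = (\<integral>\<^sup>+x. (f x)\<^sup>2 \<partial>(M \<bind> T))"
    unfolding inv using int_f2 by (intro nn_integral_eq_integral[symmetric]) auto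
  also have "\<dots> = (\<integral>\<^sup>+x. \<integral>\<^sup>+u. (f u)\<^sup>2 \<partial>T x \<partial>M)"
    using T' by (intro nn_integral_bind[where B=M]) auto
  also have "\<dots> = (\<integral>\<^sup>+x. g x \<partial>M)"
    unfolding g_def by (intro nn_integral_cong nn_integral_eq_integral int) auto
  also have "\<dots> = ennreal (\<integral>x. g x \<partial>M)"
    using int_g g_bd by (intro nn_integral_eq_integral) auto
  finally have means: "(\<integral>x. (f x)\<^sup>2 \<partial>M) = (\<integral>x. g x \<partial>M)"
    using g_bd by (subst (asm) ennreal_inj) (auto intro!: integral_nonneg_AE)
  have var: "AE x in M. (\<integral>u. (f u - f x)\<^sup>2 \<partial>T x) \<le> g x - (f x)\<^sup>2 \<and> 0 \<le> (\<integral>u. (f u - f x)\<^sup>2 \<partial>T x)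
      \<and> integrable (T x) (\<lambda>u. (f u - f x)\<^sup>2)"
    using sub AE_space
  proof eventually_elim
    case (elim x)
    interpret X: prob_space "T x" by (rule p) (use elim in simp)
    have eq: "(\<lambda>u. (f u - f x)\<^sup>2) = (\<lambda>u. (f u)\<^sup>2 - 2 * f x * f u + (f x)\<^sup>2)"
      by (auto simp: power2_eq_square algebra_simps)
    have i: "integrable (T x) (\<lambda>u. (f u - f x)\<^sup>2)"
      unfolding eq using int[of x] elim by (intro Bochner_Integration.integrable_add Bochner_Integration.integrable_diff integrable_mult_right) auto
    have "(\<integral>u. (f u - f x)\<^sup>2 \<partial>T x) = g x - 2 * f x * (\<integral>u. f u \<partial>T x) + (f x)\<^sup>2"
      unfolding eq g_def using int[of x] elim by (simp add: X.prob_space)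
    moreover have "f x * f x \<le> f x * (\<integral>u. f u \<partial>T x)"
      using elim bounds by (intro mult_left_mono) auto
    ultimately have "(\<integral>u. (f u - f x)\<^sup>2 \<partial>T x) \<le> g x - (f x)\<^sup>2"
      by (simp add: power2_eq_square)
    moreover have "0 \<le> (\<integral>u. (f u - f x)\<^sup>2 \<partial>T x)"
      by (intro integral_nonneg_AE) auto
    ultimately show ?case using i by blast
  qed
  have "AE x in M. g x - (f x)\<^sup>2 = 0"
  proof (subst integral_nonneg_eq_0_iff_AE[symmetric])
    show "AE x in M. 0 \<le> g x - (f x)\<^sup>2" using var by eventually_elim linarith
  qed (use int_g int_f2 means in auto)
  with var AE_space show ?thesis
  proof eventually_elim
    case (elim x)
    then have "(\<integral>u. (f u - f x)\<^sup>2 \<partial>T x) = 0" by linarith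
    then have "AE u in T x. (f u - f x)\<^sup>2 = 0"
      using elim by (subst (asm) integral_nonneg_eq_0_iff_AE) auto
    then show ?case by eventually_elim simp
  qed
qed

section \<open>A zero-one law\<close>

text \<open>
  Kolmogorov's argument: an event that is independent of every member of an increasing family of
  \<open>\<pi>\<close>-systems is independent of the sigma-field that they generate, to which it belongs.
\<close>

lemma (in prob_space) zero_one_of_indep_approximation:
  assumes A: "A \<in> sigma_sets (space M) (\<Union>n. \<V> n)" and \<V>: "incseq \<V>" "\<And>n. \<V> n \<subseteq> events" "\<And>n. Int_stable (\<V> n)"
    and indep: "\<And>n B. B \<in> \<V> n \<Longrightarrow> prob (A \<inter> B) = prob A * prob B"
  shows "prob A = (prob A)\<^sup>2"
proof -
  have sub: "(\<Union>n. \<V> n) \<subseteq> events" using \<V>(2) by blast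
  have Ae: "A \<in> events" using A sub sets.sigma_sets_subset by blast
  have "indep_set (sigma_sets (space M) {A}) (sigma_sets (space M) (\<Union>n. \<V> n))"
  proof (rule indep_set_sigma_sets)
    show "indep_set {A} (\<Union>n. \<V> n)"
      using Ae sub indep by (intro indep_setI) auto
    show "Int_stable {A}" by (auto simp: Int_stable_def)
    show "Int_stable (\<Union>n. \<V> n)"
    proof (rule Int_stableI)
      fix a b assume "a \<in> (\<Union>n. \<V> n)" "b \<in> (\<Union>n. \<V> n)"
      then obtain i j where "a \<in> \<V> i" "b \<in> \<V> j" by auto
      then have "a \<in> \<V> (max i j)" "b \<in> \<V> (max i j)"
        using incseqD[OF \<V>(1), of i "max i j"] incseqD[OF \<V>(1), of j "max i j"] by auto
      then show "a \<inter> b \<in> (\<Union>n. \<V> n)" using Int_stableD[OF \<V>(3)] by blast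
    qed
  qed
  from indep_setD[OF this _ A, of A] show ?thesis by (auto simp: power2_eq_square)
qed

section \<open>Kernels and disintegration\<close>

lemma countable_generator_borel:
  obtains \<E> :: "'b::second_countable_topology set set"
  where "countable \<E>" "Int_stable \<E>" "UNIV \<in> \<E>" "sets borel = sigma_sets UNIV \<E>"
proof -
  obtain \<B> :: "'b set set" where \<B>: "countable \<B>" "topological_basis \<B>"
    using ex_countable_basis by blast
  define \<E> where "\<E> = Inter ` {F. finite F \<and> F \<subseteq> \<B>}"
  have sub: "\<B> \<subseteq> \<E>" unfolding \<E>_def by (auto intro!: image_eqI[of _ _ "{_}"])
  show ?thesis
  proof (rule that)
    show "countable \<E>"
      unfolding \<E>_def using countable_Collect_finite_subset[OF \<B>(1)] by (intro countable_image) auto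
    show "UNIV \<in> \<E>" unfolding \<E>_def by (auto intro!: image_eqI[of _ _ "{}"])
    show "Int_stable \<E>"
    proof (rule Int_stableI)
      fix a b assume "a \<in> \<E>" "b \<in> \<E>"
      then obtain F F' where "finite F" "F \<subseteq> \<B>" "a = \<Inter>F" "finite F'" "F' \<subseteq> \<B>" "b = \<Inter>F'"
        by (auto simp: \<E>_def)
      then show "a \<inter> b \<in> \<E>"
        unfolding \<E>_def by (intro image_eqI[of _ _ "F \<union> F'"]) auto
    qed
    have bs: "sets borel = sigma_sets UNIV \<B>"
      unfolding borel_eq_countable_basis[OF \<B>] by (rule sets_measure_of) simp
    have "\<E> \<subseteq> sets borel"
    proof
      fix a assume "a \<in> \<E>"
      then obtain F where "finite F" "F \<subseteq> \<B>" "a = \<Inter>F" by (auto simp: \<E>_def)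
      then show "a \<in> sets borel"
        using topological_basis_open[OF \<B>(2)] by (auto intro!: borel_open open_Inter)
    qed
    then show "sets borel = sigma_sets UNIV \<E>"
      unfolding bs using sigma_sets_mono[of \<E> UNIV \<B>] sigma_sets_mono'[OF sub, of UNIV] by auto
  qed
qed

text \<open>
  Uniqueness of regular conditional probabilities: for each set of a countable generator the two
  kernels are densities of the same measure, and a measure is determined by its values on the
  generator.
\<close>

lemma (in prob_space) kernel_AE_eq:
  fixes \<kappa> \<kappa>' :: "'a \<Rightarrow> 'b::second_countable_topology measure"
  assumes \<kappa>: "\<kappa> \<in> M \<rightarrow>\<^sub>M prob_algebra borel" "\<kappa>' \<in> M \<rightarrow>\<^sub>M prob_algebra borel"
    and eq: "\<And>A B. A \<in> sets borel \<Longrightarrow> B \<in> sets M \<Longrightarrow>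
      (\<integral>\<^sup>+x. emeasure (\<kappa> x) A * indicator B x \<partial>M) = (\<integral>\<^sup>+x. emeasure (\<kappa>' x) A * indicator B x \<partial>M)"
  shows "AE x in M. \<kappa> x = \<kappa>' x"
proof -
  obtain \<E> :: "'b set set" where \<E>: "countable \<E>" "Int_stable \<E>" "UNIV \<in> \<E>" "sets borel = sigma_sets UNIV \<E>"
    by (rule countable_generator_borel)
  have "AE x in M. emeasure (\<kappa> x) A = emeasure (\<kappa>' x) A" if "A \<in> \<E>" for A
  proof (rule density_unique)
    have A: "A \<in> sets borel" using that \<E>(4) by auto
    show m: "(\<lambda>x. emeasure (\<kappa> x) A) \<in> borel_measurable M" "(\<lambda>x. emeasure (\<kappa>' x) A) \<in> borel_measurable M"
      using measurable_compose[OF measurable_prob_algebraD[OF \<kappa>(1)] measurable_emeasure_subprob_algebra[OF A]]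
        measurable_compose[OF measurable_prob_algebraD[OF \<kappa>(2)] measurable_emeasure_subprob_algebra[OF A]]
      by auto
    show "density M (\<lambda>x. emeasure (\<kappa> x) A) = density M (\<lambda>x. emeasure (\<kappa>' x) A)"
      using eq[OF A] m by (intro measure_eqI) (auto simp: emeasure_density)
  qed
  then have "AE x in M. \<forall>A\<in>\<E>. emeasure (\<kappa> x) A = emeasure (\<kappa>' x) A"
    using \<E>(1) by (intro AE_ball_countable') auto
  with AE_space show ?thesis
  proof eventually_elim
    case (elim x)
    then have p: "prob_space (\<kappa> x)" "sets (\<kappa> x) = sets borel" "sets (\<kappa>' x) = sets borel"
      using measurable_space[OF \<kappa>(1)] measurable_space[OF \<kappa>(2)] by (auto simp: space_prob_algebra)
    interpret K: prob_space "\<kappa> x" by fact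
    show ?case
      using \<E> p elim by (intro measure_eqI_generator_eq[of \<E> UNIV _ _ "\<lambda>_. UNIV"]) auto
  qed
qed

lemma prob_measure_eq_on_rectangles:
  fixes M N :: "('a::topological_space \<times> 'b::topological_space) measure"
  assumes "prob_space M" "sets M = sets (borel \<Otimes>\<^sub>M borel)" "sets N = sets (borel \<Otimes>\<^sub>M borel)"
    and "\<And>A B. A \<in> sets borel \<Longrightarrow> B \<in> sets borel \<Longrightarrow> emeasure M (A \<times> B) = emeasure N (A \<times> B)"
  shows "M = N"
proof -
  interpret prob_space M by fact
  let ?E = "{A \<times> B | A B. A \<in> sets (borel :: 'a measure) \<and> B \<in> sets (borel :: 'b measure)}"
  show ?thesis
  proof (rule measure_eqI_generator_eq[of ?E UNIV _ _ "\<lambda>_. UNIV"])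
    show "Int_stable ?E" by (rule Int_stable_pair_measure_generator)
    show "range (\<lambda>_::nat. UNIV) \<subseteq> ?E" by (auto intro!: exI[of _ UNIV])
  qed (use assms in \<open>auto simp: sets_pair_measure\<close>)
qed

lemma regular_cond_prob_kernel:
  assumes "sets P = sets borel" "regular_cond_prob P H X \<kappa>"
  shows "\<kappa> \<in> borel \<rightarrow>\<^sub>M prob_algebra borel"
proof -
  have "prob_algebra P = prob_algebra borel"
    unfolding prob_algebra_def using subprob_algebra_cong[OF assms(1)] by simp
  then show ?thesis using assms(2) by (simp add: regular_cond_prob_def)
qed

text \<open>
  Disintegration: the defining property concerns one event at a time; here it is extended from
  rectangles to functions of the conditioning variable and the path.
\<close>

lemma regular_cond_prob_nn_integral:
  fixes X :: "'w::second_countable_topology \<Rightarrow> 'b::second_countable_topology"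
  assumes P: "prob_space P" "sets P = sets borel" and rcp: "regular_cond_prob P H X \<kappa>"
    and H: "subalgebra P H" "X \<in> H \<rightarrow>\<^sub>M borel"
    and f: "f \<in> borel_measurable (borel \<Otimes>\<^sub>M borel)"
  shows "(\<integral>\<^sup>+\<omega>. f (X \<omega>, \<omega>) \<partial>P) = (\<integral>\<^sup>+\<omega>. \<integral>\<^sup>+\<omega>'. f (X \<omega>, \<omega>') \<partial>\<kappa> (X \<omega>) \<partial>P)"
proof -
  interpret prob_space P by fact
  interpret finite_measure_subalgebra P H
    by unfold_locales (rule H(1))
  have sp [simp]: "space P = UNIV" using sets_eq_imp_space_eq[OF P(2)] by simp
  note [measurable_cong] = P(2)
  have \<kappa> [measurable]: "\<kappa> \<in> borel \<rightarrow>\<^sub>M prob_algebra borel"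
    using P(2) rcp by (rule regular_cond_prob_kernel)
  have X [measurable]: "X \<in> borel \<rightarrow>\<^sub>M borel"
    using measurable_from_subalg[OF H] P(2) by (simp cong: measurable_cong_sets)
  have XP [measurable]: "X \<in> P \<rightarrow>\<^sub>M borel" by measurable
  have \<kappa>_prob: "prob_space (\<kappa> x)" "sets (\<kappa> x) = sets borel" for x
    using measurable_space[OF \<kappa>, of x] by (auto simp: space_prob_algebra)
  have \<kappa>_sp [simp]: "space (\<kappa> x) = UNIV" for x
    using sets_eq_imp_space_eq[OF \<kappa>_prob(2)[of x]] by simp
  have \<kappa>X: "(\<lambda>\<omega>. \<kappa> (X \<omega>)) \<in> P \<rightarrow>\<^sub>M prob_algebra borel" by measurable
  define N where "N \<omega> = distr (\<kappa> (X \<omega>)) (borel \<Otimes>\<^sub>M borel) (Pair (X \<omega>))" for \<omega>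
  have N: "N \<in> P \<rightarrow>\<^sub>M prob_algebra (borel \<Otimes>\<^sub>M borel)"
    unfolding N_def by (rule measurable_distr_prob_space2[OF \<kappa>X], unfold split_beta)
      (intro measurable_Pair measurable_compose[OF measurable_fst XP] measurable_snd)
  note N' = measurable_prob_algebraD[OF N]
  have Pair: "Pair x \<in> \<kappa> x' \<rightarrow>\<^sub>M borel \<Otimes>\<^sub>M borel" for x :: 'b and x'
    using measurable_Pair1'[of x borel borel] \<kappa>_prob(2)[of x'] by (simp cong: measurable_cong_sets)
  have graph: "(\<lambda>\<omega>. (X \<omega>, \<omega>)) \<in> P \<rightarrow>\<^sub>M borel \<Otimes>\<^sub>M borel"
    by (rule measurable_Pair[OF XP measurable_ident_sets[OF P(2)]])
  have "distr P (borel \<Otimes>\<^sub>M borel) (\<lambda>\<omega>. (X \<omega>, \<omega>)) = P \<bind> N"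
  proof (rule prob_measure_eq_on_rectangles)
    show "prob_space (distr P (borel \<Otimes>\<^sub>M borel) (\<lambda>\<omega>. (X \<omega>, \<omega>)))"
      by (rule prob_space_distr[OF graph])
    show "sets (P \<bind> N) = sets (borel \<Otimes>\<^sub>M borel)"
      using N' by (intro sets_bind[OF sets_kernel]) auto
    fix A :: "'b set" and B :: "'w set" assume [measurable]: "A \<in> sets borel" "B \<in> sets borel"
    have S: "X -` A \<in> sets H"
      using measurable_sets[OF H(2), of A] H(1) by (simp add: subalgebra_def)
    have SP: "X -` A \<in> sets P" using S H(1) by (auto simp: subalgebra_def)
    have AE: "AE \<omega> in P. measure (\<kappa> (X \<omega>)) B = real_cond_exp P H (indicator B) \<omega>"
      using rcp P(2) by (auto simp: regular_cond_prob_def)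
    have mB [measurable]: "(\<lambda>\<omega>. measure (\<kappa> (X \<omega>)) B) \<in> borel_measurable P"
      by (rule measurable_compose[OF \<kappa>X measurable_measure_prob_algebra]) simp
    have le1: "measure (\<kappa> x) B \<le> 1" for x by (intro prob_space.prob_le_1 \<kappa>_prob)
    have "prob (X -` A \<inter> B) = (\<integral>\<omega>\<in>X -` A. indicator B \<omega> \<partial>P)"
      using SP P(2) by (simp add: set_lebesgue_integral_def flip: indicator_inter_arith)
    also have "\<dots> = (\<integral>\<omega>\<in>X -` A. real_cond_exp P H (indicator B) \<omega> \<partial>P)"
      using S P(2) by (intro real_cond_exp_intA) (auto simp: emeasure_eq_measure)
    also have "\<dots> = (\<integral>\<omega>\<in>X -` A. measure (\<kappa> (X \<omega>)) B \<partial>P)"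
      using AE SP by (intro set_lebesgue_integral_cong_AE) (auto elim: eventually_mono)
    finally have "emeasure P (X -` A \<inter> B) = ennreal (\<integral>\<omega>. indicator (X -` A) \<omega> * measure (\<kappa> (X \<omega>)) B \<partial>P)"
      by (simp add: emeasure_eq_measure set_lebesgue_integral_def)
    also have "\<dots> = (\<integral>\<^sup>+\<omega>. ennreal (indicator (X -` A) \<omega> * measure (\<kappa> (X \<omega>)) B) \<partial>P)"
      using SP le1 by (intro nn_integral_eq_integral[symmetric] integrable_const_bound[of _ 1])
        (auto simp: indicator_def)
    also have "\<dots> = (\<integral>\<^sup>+\<omega>. emeasure (N \<omega>) (A \<times> B) \<partial>P)"
    proof (rule nn_integral_cong)
      fix \<omega>
      interpret K: prob_space "\<kappa> (X \<omega>)" by (rule \<kappa>_prob)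
      have "emeasure (N \<omega>) (A \<times> B) = emeasure (\<kappa> (X \<omega>)) (Pair (X \<omega>) -` (A \<times> B))"
        unfolding N_def by (subst emeasure_distr) (auto simp: Pair)
      also have "Pair (X \<omega>) -` (A \<times> B) = (if X \<omega> \<in> A then B else {})" by auto
      finally show "ennreal (indicator (X -` A) \<omega> * measure (\<kappa> (X \<omega>)) B) = emeasure (N \<omega>) (A \<times> B)"
        by (auto simp: K.emeasure_eq_measure)
    qed
    also have "\<dots> = emeasure (P \<bind> N) (A \<times> B)"
      using N' by (intro emeasure_bind[symmetric]) (auto simp: not_empty)
    finally show "emeasure (distr P (borel \<Otimes>\<^sub>M borel) (\<lambda>\<omega>. (X \<omega>, \<omega>))) (A \<times> B) = emeasure (P \<bind> N) (A \<times> B)"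
      using graph by (subst emeasure_distr) (auto simp: vimage_def Int_def)
  qed auto
  then have "(\<integral>\<^sup>+u. f u \<partial>distr P (borel \<Otimes>\<^sub>M borel) (\<lambda>\<omega>. (X \<omega>, \<omega>))) = (\<integral>\<^sup>+u. f u \<partial>(P \<bind> N))"
    by simp
  moreover have "(\<integral>\<^sup>+u. f u \<partial>distr P (borel \<Otimes>\<^sub>M borel) (\<lambda>\<omega>. (X \<omega>, \<omega>))) = (\<integral>\<^sup>+\<omega>. f (X \<omega>, \<omega>) \<partial>P)"
    using f by (intro nn_integral_distr graph) simp
  moreover have "(\<integral>\<^sup>+u. f u \<partial>(P \<bind> N)) = (\<integral>\<^sup>+\<omega>. \<integral>\<^sup>+u. f u \<partial>N \<omega> \<partial>P)"
    using f N' by (rule nn_integral_bind)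
  moreover have "(\<integral>\<^sup>+u. f u \<partial>N \<omega>) = (\<integral>\<^sup>+\<omega>'. f (X \<omega>, \<omega>') \<partial>\<kappa> (X \<omega>))" for \<omega>
    unfolding N_def using f by (intro nn_integral_distr Pair) simp
  ultimately show ?thesis by simp
qed

section \<open>Shifts and the information at a given time\<close>

definition shift :: "int \<Rightarrow> (int \<Rightarrow> 'a) \<Rightarrow> int \<Rightarrow> 'a" where
  "shift n \<omega> = (\<lambda>k. \<omega> (k + n))"

lemma shift_shift [simp]: "shift m (shift n \<omega>) = shift (m + n) \<omega>"
  by (simp add: shift_def ac_simps)

lemma shift_0 [simp]: "shift 0 \<omega> = \<omega>"
  by (simp add: shift_def)

lemma measurable_shift [measurable]:
  "(shift n :: (int \<Rightarrow> 'a::second_countable_topology) \<Rightarrow> _) \<in> borel \<rightarrow>\<^sub>M borel"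
  unfolding shift_def by (intro measurable_coordinatewise_then_product measurable_product_coordinates)

lemma measurable_past [measurable]:
  "(past :: (int \<Rightarrow> 'a::second_countable_topology) \<Rightarrow> _) \<in> borel \<rightarrow>\<^sub>M borel"
  unfolding past_def by (intro measurable_coordinatewise_then_product measurable_product_coordinates)

lemma stationary_shift:
  fixes P :: "(int \<Rightarrow> 'a::second_countable_topology) measure"
  assumes P: "sets P = sets borel" and "stationary P"
  shows "distr P borel (shift n) = P"
proof -
  note [measurable_cong] = P
  have sh [measurable]: "shift k \<in> P \<rightarrow>\<^sub>M P" for k :: int by measurable
  have one: "distr P P (shift 1) = P"
    using assms(2) by (simp add: stationary_def shift_def[abs_def])
  have pos: "distr P P (shift (int k)) = P" for k
  proof (induction k)
    case 0
    have "distr P P (shift 0) = distr P P (\<lambda>x. x)" by (intro distr_cong) auto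
    then show ?case by simp
  next
    case (Suc k)
    have "distr P P (shift (int (Suc k))) = distr (distr P P (shift (int k))) P (shift 1)"
      by (subst distr_distr) (auto simp: comp_def)
    then show ?case using Suc one by simp
  qed
  have "distr P P (shift n) = P"
  proof (cases "n \<ge> 0")
    case True
    then show ?thesis using pos[of "nat n"] by simp
  next
    case False
    have "distr P P (shift n) = distr (distr P P (shift (- n))) P (shift n)"
      using pos[of "nat (- n)"] False by simp
    also have "\<dots> = distr P P (\<lambda>x. x)"
      by (subst distr_distr) (auto simp: comp_def intro!: distr_cong)
    finally show ?thesis by simp
  qed
  moreover have "distr P borel (shift n) = distr P P (shift n)"
    using P by (intro distr_cong) auto
  ultimately show ?thesis by simp
qed

lemma borel_measurable_fst: "fst \<in> (borel :: ('a::second_countable_topology \<times> 'b::second_countable_topology) measure) \<rightarrow>\<^sub>M borel"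
  and borel_measurable_snd: "snd \<in> (borel :: ('a::second_countable_topology \<times> 'b::second_countable_topology) measure) \<rightarrow>\<^sub>M borel"
  by (subst borel_prod[symmetric], rule measurable_fst measurable_snd)+

definition observed :: "('g, 'f) path \<Rightarrow> (int \<Rightarrow> 'f) \<times> (nat \<Rightarrow> 'g)" where
  "observed \<omega> = (Y_path \<omega>, past (Z_path \<omega>))"

lemma measurable_observed [measurable]:
  "(observed :: ('g::second_countable_topology, 'f::second_countable_topology) path \<Rightarrow> _) \<in> borel \<rightarrow>\<^sub>M borel"
  unfolding observed_def
  by (intro borel_measurable_Pair measurable_Y_path measurable_compose[OF measurable_Z_path measurable_past])

lemma Y_path_shift: "Y_path (shift n \<omega>) = shift n (Y_path \<omega>)"
  by (simp add: Y_path_def Y_coord_def shift_def)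

text \<open>
  Information at time \<open>n\<close> contains the information at time \<open>0\<close>; \<open>rewind n\<close> recovers the latter from
  the former.
\<close>

definition rewind :: "nat \<Rightarrow> (int \<Rightarrow> 'f) \<times> (nat \<Rightarrow> 'g) \<Rightarrow> (int \<Rightarrow> 'f) \<times> (nat \<Rightarrow> 'g)" where
  "rewind n x = (shift (- int n) (fst x), \<lambda>k. snd x (k + n))"

lemma rewind_observed: "rewind n (observed (shift (int n) \<omega>)) = observed \<omega>"
  by (simp add: rewind_def observed_def Y_path_shift past_def Z_path_def Z_coord_def)
    (simp add: shift_def)

lemma measurable_rewind [measurable]:
  "(rewind n :: (int \<Rightarrow> 'f::second_countable_topology) \<times> (nat \<Rightarrow> 'g::second_countable_topology) \<Rightarrow> _)
    \<in> borel \<rightarrow>\<^sub>M borel"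
  unfolding rewind_def[abs_def]
  by (intro borel_measurable_Pair measurable_compose[OF borel_measurable_fst measurable_shift]
      measurable_coordinatewise_then_product
      measurable_compose[OF borel_measurable_snd measurable_product_coordinates])

lemma measurable_field_of:
  fixes X :: "int \<Rightarrow> 'w \<Rightarrow> 'b::topological_space"
  shows "k \<in> I \<Longrightarrow> X k \<in> field_of X I \<rightarrow>\<^sub>M borel"
  unfolding field_of_def by (intro measurableI) (auto intro!: sigma_sets.Basic)

lemma space_field_of [simp]: "space (field_of X I) = UNIV"
  by (simp add: field_of_def space_measure_of_conv)

lemma sets_field_of: "sets (field_of X I) = sigma_sets UNIV {X k -` B | k B. k \<in> I \<and> B \<in> sets borel}"
  unfolding field_of_def by (rule sets_measure_of) simp

lemma sets_field_of_subset:
  assumes "\<And>k. k \<in> I \<Longrightarrow> X k \<in> M \<rightarrow>\<^sub>M borel" "space M = UNIV"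
  shows "sets (field_of X I) \<subseteq> sets M"
  unfolding sets_field_of
proof (rule sets.sigma_sets_subset'[of _ M, unfolded assms(2)])
  show "{X k -` B | k B. k \<in> I \<and> B \<in> sets borel} \<subseteq> sets M"
    using measurable_sets[OF assms(1)] assms(2) by auto
  show "UNIV \<in> sets M" using sets.top[of M] assms(2) by simp
qed

lemma measurable_Z_coord [measurable]:
  "(Z_coord k :: ('g::second_countable_topology, 'f::second_countable_topology) path \<Rightarrow> _) \<in> borel \<rightarrow>\<^sub>M borel"
  using measurable_product_then_coordinatewise[OF measurable_Z_path, of k] by (simp add: Z_path_def)

lemma measurable_Y_coord [measurable]:
  "(Y_coord k :: ('g::second_countable_topology, 'f::second_countable_topology) path \<Rightarrow> _) \<in> borel \<rightarrow>\<^sub>M borel"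
  using measurable_product_then_coordinatewise[OF measurable_Y_path, of k] by (simp add: Y_path_def)

lemma measurable_field_join:
  assumes "f \<in> M \<rightarrow>\<^sub>M L \<or> f \<in> N \<rightarrow>\<^sub>M L" "space M = UNIV" "space N = UNIV"
  shows "f \<in> field_join M N \<rightarrow>\<^sub>M L"
proof -
  have sp: "space (field_join M N) = UNIV" by (simp add: field_join_def space_measure_of_conv)
  have "sets M \<union> sets N \<subseteq> sets (field_join M N)"
    unfolding field_join_def by (subst sets_measure_of) (auto intro: sigma_sets.Basic)
  then show ?thesis
    using assms sp unfolding measurable_def by auto
qed

section \<open>The Markov chain of information\<close>

locale conditioned_process =
  fixes P :: "('g::polish_space, 'f::polish_space) path measure"
    and Py :: "(int \<Rightarrow> 'f) \<Rightarrow> ('g, 'f) path measure"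
    and K :: "(int \<Rightarrow> 'f) \<times> (nat \<Rightarrow> 'g) \<Rightarrow> ('g, 'f) path measure"
  assumes prob_P: "prob_space P" and sets_P: "sets P = sets borel" and stat: "stationary P"
    and rcp_Py: "regular_cond_prob P (F_Y UNIV) Y_path Py"
    and rcp_K: "regular_cond_prob P (field_join (F_Y UNIV) (F_Z {..0})) observed K"
begin

sublocale law: prob_space P by (rule prob_P)

lemma space_P [simp]: "space P = UNIV"
  using sets_eq_imp_space_eq[OF sets_P] by simp

lemma Py [measurable]: "Py \<in> borel \<rightarrow>\<^sub>M prob_algebra borel"
  using sets_P rcp_Py by (rule regular_cond_prob_kernel)

lemma K [measurable]: "K \<in> borel \<rightarrow>\<^sub>M prob_algebra borel"
  using sets_P rcp_K by (rule regular_cond_prob_kernel)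

lemma K_props: "prob_space (K x)" "sets (K x) = sets borel" "space (K x) = UNIV"
proof -
  show "prob_space (K x)" and s: "sets (K x) = sets borel"
    using measurable_space[OF K, of x] by (auto simp: space_prob_algebra)
  show "space (K x) = UNIV" using sets_eq_imp_space_eq[OF s] by simp
qed

lemma Py_props: "prob_space (Py y)" "sets (Py y) = sets borel" "space (Py y) = UNIV"
proof -
  show "prob_space (Py y)" and s: "sets (Py y) = sets borel"
    using measurable_space[OF Py, of y] by (auto simp: space_prob_algebra)
  show "space (Py y) = UNIV" using sets_eq_imp_space_eq[OF s] by simp
qed

lemma measurable_P: "measurable P N = measurable borel N"
  by (rule measurable_cong_sets[OF sets_P refl])

lemma measurable_K: "measurable (K x) N = measurable borel N"
  by (rule measurable_cong_sets[OF K_props(2) refl])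

lemma measurable_Py: "measurable (Py y) N = measurable borel N"
  by (rule measurable_cong_sets[OF Py_props(2) refl])

lemma Y_disintegration:
  assumes f: "f \<in> borel_measurable borel"
  shows "(\<integral>\<^sup>+\<omega>. \<integral>\<^sup>+\<omega>'. f (Y_path \<omega>, \<omega>') \<partial>Py (Y_path \<omega>) \<partial>P) = (\<integral>\<^sup>+\<omega>. f (Y_path \<omega>, \<omega>) \<partial>P)"
proof (rule regular_cond_prob_nn_integral[OF prob_P sets_P rcp_Py, symmetric])
  show "subalgebra P (F_Y UNIV)"
    unfolding subalgebra_def using sets_field_of_subset[of UNIV Y_coord P]
    by (auto simp: measurable_P)
  show "(Y_path :: ('g, 'f) path \<Rightarrow> _) \<in> F_Y UNIV \<rightarrow>\<^sub>M borel"
    unfolding Y_path_def by (intro measurable_coordinatewise_then_product measurable_field_of) auto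
  show "f \<in> borel_measurable (borel \<Otimes>\<^sub>M borel)" using f by (simp add: borel_prod)
qed

lemma observed_disintegration:
  assumes f: "f \<in> borel_measurable borel"
  shows "(\<integral>\<^sup>+\<omega>. \<integral>\<^sup>+\<omega>'. f (observed \<omega>, \<omega>') \<partial>K (observed \<omega>) \<partial>P) = (\<integral>\<^sup>+\<omega>. f (observed \<omega>, \<omega>) \<partial>P)"
proof (rule regular_cond_prob_nn_integral[OF prob_P sets_P rcp_K, symmetric])
  let ?H = "field_join (F_Y UNIV) (F_Z {..0}) :: ('g, 'f) path measure"
  have "sets (F_Y UNIV) \<subseteq> sets P" "sets (F_Z {..0}) \<subseteq> sets P"
    by (rule sets_field_of_subset; simp add: measurable_P)+
  then show "subalgebra P ?H"
    unfolding subalgebra_def field_join_def using sets.sigma_sets_subset[of "sets (F_Y UNIV) \<union> sets (F_Z {..0})" P]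
    by (simp add: space_measure_of_conv)
  show "observed \<in> ?H \<rightarrow>\<^sub>M borel"
    unfolding observed_def[abs_def] Y_path_def past_def Z_path_def
    by (intro borel_measurable_Pair measurable_coordinatewise_then_product measurable_field_join)
      (auto intro: measurable_field_of)
  show "f \<in> borel_measurable (borel \<Otimes>\<^sub>M borel)" using f by (simp add: borel_prod)
qed

lemma nn_integral_shift:
  assumes "f \<in> borel_measurable borel"
  shows "(\<integral>\<^sup>+\<omega>. f (shift n \<omega>) \<partial>P) = (\<integral>\<^sup>+\<omega>. f \<omega> \<partial>P)"
proof -
  have "(\<integral>\<^sup>+\<omega>. f \<omega> \<partial>P) = (\<integral>\<^sup>+\<omega>. f \<omega> \<partial>distr P borel (shift n))"
    by (simp add: stationary_shift[OF sets_P stat])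
  also have "\<dots> = (\<integral>\<^sup>+\<omega>. f (shift n \<omega>) \<partial>P)"
    using assms by (intro nn_integral_distr) (simp_all add: measurable_P)
  finally show ?thesis by simp
qed

text \<open>
  The \<open>n\<close>-step transition kernel of the information process.
\<close>

definition step :: "nat \<Rightarrow> (int \<Rightarrow> 'f) \<times> (nat \<Rightarrow> 'g) \<Rightarrow> ((int \<Rightarrow> 'f) \<times> (nat \<Rightarrow> 'g)) measure" where
  "step n x = distr (K x) borel (\<lambda>\<omega>. observed (shift (int n) \<omega>))"

definition observed_law :: "((int \<Rightarrow> 'f) \<times> (nat \<Rightarrow> 'g)) measure" where
  "observed_law = distr P borel observed"

lemma observed_shift [measurable]: "(\<lambda>\<omega>::('g, 'f) path. observed (shift k \<omega>)) \<in> borel \<rightarrow>\<^sub>M borel"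
  by (rule measurable_compose[OF measurable_shift measurable_observed])

lemma step [measurable]: "step n \<in> borel \<rightarrow>\<^sub>M prob_algebra borel"
  unfolding step_def[abs_def] by (rule measurable_compose[OF K measurable_distr_prob_space[OF observed_shift]])

lemma step_props: "prob_space (step n x)" "sets (step n x) = sets borel" "space (step n x) = UNIV"
  using measurable_space[OF step, of x n] by (auto simp: space_prob_algebra step_def)

lemma prob_observed_law: "prob_space observed_law"
  unfolding observed_law_def by (intro law.prob_space_distr) (simp add: measurable_P)

lemma nn_integral_observed_law:
  "f \<in> borel_measurable borel \<Longrightarrow> (\<integral>\<^sup>+x. f x \<partial>observed_law) = (\<integral>\<^sup>+\<omega>. f (observed \<omega>) \<partial>P)"
  unfolding observed_law_def by (intro nn_integral_distr) (simp_all add: measurable_P)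

lemma measurable_emeasure_kernel:
  "\<kappa> \<in> M \<rightarrow>\<^sub>M prob_algebra N \<Longrightarrow> A \<in> sets N \<Longrightarrow> (\<lambda>x. emeasure (\<kappa> x) A) \<in> borel_measurable M"
  by (rule measurable_compose[OF measurable_prob_algebraD measurable_emeasure_subprob_algebra])

definition graph_kernel ::
    "(int \<Rightarrow> 'f) \<times> (nat \<Rightarrow> 'g) \<Rightarrow> (((int \<Rightarrow> 'f) \<times> (nat \<Rightarrow> 'g)) \<times> ('g, 'f) path) measure" where
  "graph_kernel x = distr (K x) borel (Pair x)"

lemma measurable_Pair_const: "Pair x \<in> (borel :: ('g, 'f) path measure) \<rightarrow>\<^sub>M borel"
  for x :: "(int \<Rightarrow> 'f) \<times> (nat \<Rightarrow> 'g)"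
  by (intro borel_measurable_Pair) auto

lemma graph_kernel: "graph_kernel \<in> borel \<rightarrow>\<^sub>M prob_algebra borel"
  unfolding graph_kernel_def[abs_def]
  by (rule measurable_distr_prob_space2[OF K]) (simp add: borel_prod)

text \<open>
  The joint law, under \<open>K x\<close>, of the information at time \<open>n\<close> and of the path seen from that time
  is obtained by moving \<open>n\<close> steps and then drawing the path from \<open>K\<close>. This is the tower property
  combined with stationarity. Both sides are kernels in \<open>x\<close>, so it suffices to compare their means over
  sets \<open>B\<close>; the expectation is moved to time \<open>n\<close> by a shift, for which \<open>B\<close> is read off
  the later information by \<open>rewind\<close>.
\<close>

lemma Markov_property_at:
  "AE x in observed_law. distr (K x) borel (\<lambda>\<omega>. (observed (shift (int n) \<omega>), shift (int n) \<omega>)) = step n x \<bind> graph_kernel"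
proof -
  interpret O: prob_space observed_law by (rule prob_observed_law)
  let ?g = "\<lambda>\<omega>::('g, 'f) path. (observed (shift (int n) \<omega>), shift (int n) \<omega>)"
  have g: "?g \<in> borel \<rightarrow>\<^sub>M borel"
    by (intro borel_measurable_Pair observed_shift measurable_shift)
  have l: "(\<lambda>x. distr (K x) borel ?g) \<in> borel \<rightarrow>\<^sub>M prob_algebra borel"
    by (rule measurable_compose[OF K measurable_distr_prob_space[OF g]])
  have r: "(\<lambda>x. step n x \<bind> graph_kernel) \<in> borel \<rightarrow>\<^sub>M prob_algebra borel"
    by (rule measurable_bind_prob_space[OF step graph_kernel])
  have ol: "measurable observed_law N = measurable borel N" for N :: "'c measure"
    by (rule measurable_cong_sets) (simp_all add: observed_law_def)
  show ?thesis
  proof (rule O.kernel_AE_eq)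
    show "(\<lambda>x. distr (K x) borel ?g) \<in> observed_law \<rightarrow>\<^sub>M prob_algebra borel"
      "(\<lambda>x. step n x \<bind> graph_kernel) \<in> observed_law \<rightarrow>\<^sub>M prob_algebra borel"
      using l r by (simp_all add: ol)
    fix A :: "(((int \<Rightarrow> 'f) \<times> (nat \<Rightarrow> 'g)) \<times> ('g, 'f) path) set" and B
    assume A: "A \<in> sets borel" and "B \<in> sets observed_law"
    then have B: "B \<in> sets borel" by (simp add: observed_law_def)
    have iA: "indicator A \<in> borel_measurable (borel :: (((int \<Rightarrow> 'f) \<times> (nat \<Rightarrow> 'g)) \<times> ('g, 'f) path) measure)"
      "(indicator B :: _ \<Rightarrow> ennreal) \<in> borel_measurable borel"
      using A B by auto
    have gk: "emeasure (graph_kernel x) A = (\<integral>\<^sup>+\<omega>. indicator A (x, \<omega>) \<partial>K x)" for x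
      using A measurable_Pair_const[of x] unfolding graph_kernel_def
      by (subst nn_integral_indicator[symmetric], simp)
        (subst nn_integral_distr, auto simp: measurable_K)
    have gk_m: "(\<lambda>x. emeasure (graph_kernel x) A) \<in> borel_measurable borel"
      using graph_kernel A by (rule measurable_emeasure_kernel)
    have "(\<integral>\<^sup>+x. emeasure (distr (K x) borel ?g) A * indicator B x \<partial>observed_law)
        = (\<integral>\<^sup>+\<omega>. emeasure (distr (K (observed \<omega>)) borel ?g) A * indicator B (observed \<omega>) \<partial>P)"
      using iA measurable_emeasure_kernel[OF l A] by (intro nn_integral_observed_law) auto
    also have "\<dots> = (\<integral>\<^sup>+\<omega>. \<integral>\<^sup>+\<omega>'. indicator A (?g \<omega>') * indicator B (observed \<omega>) \<partial>K (observed \<omega>) \<partial>P)"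
    proof (rule nn_integral_cong)
      fix \<omega>
      have m: "(\<lambda>\<omega>'. indicator A (?g \<omega>') :: ennreal) \<in> borel_measurable (K (observed \<omega>))"
        using measurable_compose[OF g iA(1)] by (simp add: measurable_K)
      have "emeasure (distr (K (observed \<omega>)) borel ?g) A = (\<integral>\<^sup>+\<omega>'. indicator A (?g \<omega>') \<partial>K (observed \<omega>))"
        using A g by (subst nn_integral_indicator[symmetric], simp) (subst nn_integral_distr, auto simp: measurable_K)
      then show "emeasure (distr (K (observed \<omega>)) borel ?g) A * indicator B (observed \<omega>)
          = (\<integral>\<^sup>+\<omega>'. indicator A (?g \<omega>') * indicator B (observed \<omega>) \<partial>K (observed \<omega>))"
        using m by (simp add: nn_integral_multc)
    qed
    also have "\<dots> = (\<integral>\<^sup>+\<omega>. indicator A (?g \<omega>) * indicator B (observed \<omega>) \<partial>P)"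
    proof (rule observed_disintegration[where f="\<lambda>(x, \<omega>'). indicator A (?g \<omega>') * indicator B x", simplified])
      show "(\<lambda>(x, \<omega>'). indicator A (?g \<omega>') * indicator B x :: ennreal) \<in> borel_measurable borel"
        unfolding split_beta
        by (intro borel_measurable_times_ennreal measurable_compose[OF borel_measurable_fst iA(2)]
            measurable_compose[OF borel_measurable_snd measurable_compose[OF g iA(1)]])
    qed
    \<comment> \<open>Written through \<open>shift n \<omega>\<close> alone, the integrand can be moved back to time \<open>0\<close> by stationarity.\<close>
    also have "\<dots> = (\<integral>\<^sup>+\<omega>. indicator A (observed (shift (int n) \<omega>), shift (int n) \<omega>) * indicator B (rewind n (observed (shift (int n) \<omega>))) \<partial>P)"
      by (simp add: rewind_observed)
    also have "\<dots> = (\<integral>\<^sup>+\<omega>. indicator A (observed \<omega>, \<omega>) * indicator B (rewind n (observed \<omega>)) \<partial>P)"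
    proof (rule nn_integral_shift[where f="\<lambda>\<omega>. indicator A (observed \<omega>, \<omega>) * indicator B (rewind n (observed \<omega>))"])
      show "(\<lambda>\<omega>. indicator A (observed \<omega>, \<omega>) * indicator B (rewind n (observed \<omega>)) :: ennreal) \<in> borel_measurable borel"
        by (intro borel_measurable_times_ennreal measurable_compose[OF _ iA(1)] borel_measurable_Pair measurable_observed
            measurable_compose[OF measurable_observed measurable_compose[OF measurable_rewind iA(2)]]) simp
    qed
    also have "\<dots> = (\<integral>\<^sup>+\<omega>. \<integral>\<^sup>+\<omega>'. indicator A (observed \<omega>, \<omega>') * indicator B (rewind n (observed \<omega>)) \<partial>K (observed \<omega>) \<partial>P)"
    proof (rule observed_disintegration[where f="\<lambda>(x, \<omega>'). indicator A (x, \<omega>') * indicator B (rewind n x)", simplified, symmetric])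
      show "(\<lambda>(x, \<omega>'). indicator A (x, \<omega>') * indicator B (rewind n x) :: ennreal) \<in> borel_measurable borel"
        unfolding split_beta
        by (intro borel_measurable_times_ennreal measurable_compose[OF borel_measurable_fst measurable_compose[OF measurable_rewind iA(2)]])
          (use iA(1) in simp)
    qed
    also have "\<dots> = (\<integral>\<^sup>+\<omega>. emeasure (graph_kernel (observed \<omega>)) A * indicator B (rewind n (observed \<omega>)) \<partial>P)"
    proof (intro nn_integral_cong)
      fix \<omega>
      have "(\<lambda>\<omega>'. indicator A (observed \<omega>, \<omega>') :: ennreal) \<in> borel_measurable (K (observed \<omega>))"
        using measurable_compose[OF measurable_Pair_const iA(1)] by (simp add: measurable_K)
      then show "(\<integral>\<^sup>+\<omega>'. indicator A (observed \<omega>, \<omega>') * indicator B (rewind n (observed \<omega>)) \<partial>K (observed \<omega>))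
          = emeasure (graph_kernel (observed \<omega>)) A * indicator B (rewind n (observed \<omega>))"
        by (simp add: gk nn_integral_multc)
    qed
    also have "\<dots> = (\<integral>\<^sup>+\<omega>. emeasure (graph_kernel (observed (shift (int n) \<omega>))) A * indicator B (observed \<omega>) \<partial>P)"
    proof (subst nn_integral_shift[where n="int n" and f="\<lambda>\<omega>. emeasure (graph_kernel (observed \<omega>)) A * indicator B (rewind n (observed \<omega>))", symmetric])
      show "(\<lambda>\<omega>. emeasure (graph_kernel (observed \<omega>)) A * indicator B (rewind n (observed \<omega>))) \<in> borel_measurable borel"
        by (intro borel_measurable_times_ennreal measurable_compose[OF measurable_observed gk_m]
            measurable_compose[OF measurable_observed measurable_compose[OF measurable_rewind iA(2)]])
    qed (simp add: rewind_observed)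
    also have "\<dots> = (\<integral>\<^sup>+\<omega>. \<integral>\<^sup>+\<omega>'. emeasure (graph_kernel (observed (shift (int n) \<omega>'))) A * indicator B (observed \<omega>)
        \<partial>K (observed \<omega>) \<partial>P)"
    proof (rule observed_disintegration[where f="\<lambda>(x, \<omega>'). emeasure (graph_kernel (observed (shift (int n) \<omega>'))) A * indicator B x",
          simplified, symmetric])
      show "(\<lambda>(x, \<omega>'). emeasure (graph_kernel (observed (shift (int n) \<omega>'))) A * indicator B x) \<in> borel_measurable borel"
        unfolding split_beta
        by (intro borel_measurable_times_ennreal measurable_compose[OF borel_measurable_fst iA(2)]
            measurable_compose[OF borel_measurable_snd measurable_compose[OF observed_shift gk_m]])
    qed
    also have "\<dots> = (\<integral>\<^sup>+\<omega>. emeasure (step n (observed \<omega>) \<bind> graph_kernel) A * indicator B (observed \<omega>) \<partial>P)"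
    proof (rule nn_integral_cong)
      fix \<omega>
      have s: "step n (observed \<omega>) \<in> space (prob_algebra borel)"
        using step_props by (auto simp: space_prob_algebra)
      have m: "(\<lambda>\<omega>'. emeasure (graph_kernel (observed (shift (int n) \<omega>'))) A) \<in> borel_measurable (K (observed \<omega>))"
        using measurable_compose[OF observed_shift gk_m] by (simp add: measurable_K)
      have "emeasure (step n (observed \<omega>) \<bind> graph_kernel) A = (\<integral>\<^sup>+u. emeasure (graph_kernel u) A \<partial>step n (observed \<omega>))"
        by (rule emeasure_bind_prob_algebra[OF s graph_kernel A])
      also have "\<dots> = (\<integral>\<^sup>+\<omega>'. emeasure (graph_kernel (observed (shift (int n) \<omega>'))) A \<partial>K (observed \<omega>))"
        unfolding step_def using gk_m observed_shift by (intro nn_integral_distr) (simp_all add: measurable_K)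
      finally show "(\<integral>\<^sup>+\<omega>'. emeasure (graph_kernel (observed (shift (int n) \<omega>'))) A * indicator B (observed \<omega>) \<partial>K (observed \<omega>))
          = emeasure (step n (observed \<omega>) \<bind> graph_kernel) A * indicator B (observed \<omega>)"
        using m by (simp add: nn_integral_multc)
    qed
    also have "\<dots> = (\<integral>\<^sup>+x. emeasure (step n x \<bind> graph_kernel) A * indicator B x \<partial>observed_law)"
      using iA measurable_emeasure_kernel[OF r A] by (intro nn_integral_observed_law[symmetric]) auto
    finally show "(\<integral>\<^sup>+x. emeasure (distr (K x) borel ?g) A * indicator B x \<partial>observed_law)
        = (\<integral>\<^sup>+x. emeasure (step n x \<bind> graph_kernel) A * indicator B x \<partial>observed_law)" .
  qed
qed

text \<open>
  Almost every \<open>x\<close> satisfies this predicate; it allows the arguments below to be carried out for one fixed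
  pair of pasts.
\<close>

definition Markov_from :: "(int \<Rightarrow> 'f) \<times> (nat \<Rightarrow> 'g) \<Rightarrow> bool" where
  "Markov_from x \<longleftrightarrow> (\<forall>n. distr (K x) borel (\<lambda>\<omega>. (observed (shift (int n) \<omega>), shift (int n) \<omega>)) = step n x \<bind> graph_kernel)"

lemma AE_Markov_from: "AE x in observed_law. Markov_from x"
  unfolding Markov_from_def AE_all_countable by (intro allI Markov_property_at)

lemma measurable_measure_K: "A \<in> sets borel \<Longrightarrow> (\<lambda>x. measure (K x) A) \<in> borel_measurable borel"
  by (rule measurable_compose[OF K measurable_measure_prob_algebra])

lemma integrable_step:
  assumes "f \<in> borel_measurable borel" "\<And>u. 0 \<le> f u" "\<And>u. f u \<le> (c::real)"
  shows "integrable (step n x) f"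
proof -
  interpret S: prob_space "step n x" by (rule step_props)
  show ?thesis
    using assms step_props(2)[of n x]
    by (intro S.integrable_const_bound[of _ c]) (auto cong: measurable_cong_sets)
qed

lemma Markov_from_measure:
  assumes x: "Markov_from x" and A: "A \<in> sets borel" and B: "B \<in> sets borel"
  shows "measure (K x) ((\<lambda>\<omega>. observed (shift (int n) \<omega>)) -` B \<inter> shift (int n) -` A)
    = (\<integral>u. indicator B u * measure (K u) A \<partial>step n x)"
proof -
  let ?g = "\<lambda>\<omega>::('g, 'f) path. (observed (shift (int n) \<omega>), shift (int n) \<omega>)"
  interpret Kx: prob_space "K x" by (rule K_props)
  have s: "step n x \<in> space (prob_algebra borel)"
    using step_props by (auto simp: space_prob_algebra)
  have g: "?g \<in> borel \<rightarrow>\<^sub>M borel"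
    by (intro borel_measurable_Pair observed_shift measurable_shift)
  have BA: "B \<times> A \<in> sets borel"
    using A B unfolding borel_prod[symmetric, where 'a="(int \<Rightarrow> 'f) \<times> (nat \<Rightarrow> 'g)" and 'b="('g, 'f) path"] by simp
  have graph: "emeasure (graph_kernel u) (B \<times> A) = ennreal (indicator B u * measure (K u) A)" for u
  proof -
    interpret Ku: prob_space "K u" by (rule K_props)
    have "emeasure (graph_kernel u) (B \<times> A) = emeasure (K u) (Pair u -` (B \<times> A))"
      unfolding graph_kernel_def using BA measurable_Pair_const[of u]
      by (subst emeasure_distr) (auto simp: measurable_K K_props)
    also have "Pair u -` (B \<times> A) = (if u \<in> B then A else {})" by auto
    finally show ?thesis by (auto simp: Ku.emeasure_eq_measure)
  qed
  have "ennreal (measure (K x) (?g -` (B \<times> A))) = emeasure (distr (K x) borel ?g) (B \<times> A)"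
    using g BA by (subst emeasure_distr) (auto simp: measurable_K K_props Kx.emeasure_eq_measure)
  also have "\<dots> = (\<integral>\<^sup>+u. ennreal (indicator B u * measure (K u) A) \<partial>step n x)"
    using x emeasure_bind_prob_algebra[OF s graph_kernel BA] by (simp add: Markov_from_def graph)
  also have "\<dots> = ennreal (\<integral>u. indicator B u * measure (K u) A \<partial>step n x)"
  proof (rule nn_integral_eq_integral)
    show "integrable (step n x) (\<lambda>u. indicator B u * measure (K u) A)"
      using B measurable_measure_K[OF A] prob_space.prob_le_1[OF K_props(1)]
      by (intro integrable_step[of _ 1]) (auto simp: indicator_def)
  qed simp
  finally have "measure (K x) (?g -` (B \<times> A)) = (\<integral>u. indicator B u * measure (K u) A \<partial>step n x)"
    by (subst (asm) ennreal_inj) (auto intro!: integral_nonneg_AE)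
  moreover have "?g -` (B \<times> A) = (\<lambda>\<omega>. observed (shift (int n) \<omega>)) -` B \<inter> shift (int n) -` A" by auto
  ultimately show ?thesis by simp
qed

section \<open>The invariant law of pairs of pasts\<close>

text \<open>
  The law of the information at time \<open>0\<close> given the environment \<open>y\<close>. As in the coupling, the
  environment component is \<open>y\<close> itself and not the one of the path drawn from \<open>Py y\<close>.
\<close>

definition fibre :: "(int \<Rightarrow> 'f) \<Rightarrow> ((int \<Rightarrow> 'f) \<times> (nat \<Rightarrow> 'g)) measure" where
  "fibre y = distr (Py y) borel (\<lambda>\<omega>. (y, past (Z_path \<omega>)))"

lemma measurable_fibre_map: "(\<lambda>\<omega>::('g, 'f) path. (y :: int \<Rightarrow> 'f, past (Z_path \<omega>))) \<in> borel \<rightarrow>\<^sub>M borel"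
  by (intro borel_measurable_Pair measurable_compose[OF measurable_Z_path measurable_past]) simp

lemma measurable_fibre_map2:
  "(\<lambda>(y, \<omega>). (y :: int \<Rightarrow> 'f, past (Z_path (\<omega> :: ('g, 'f) path)))) \<in> borel \<rightarrow>\<^sub>M borel"
  unfolding split_beta
  by (intro borel_measurable_Pair borel_measurable_fst
      measurable_compose[OF borel_measurable_snd measurable_compose[OF measurable_Z_path measurable_past]])

lemma fibre [measurable]: "fibre \<in> borel \<rightarrow>\<^sub>M prob_algebra borel"
  unfolding fibre_def[abs_def]
  by (rule measurable_distr_prob_space2[OF Py]) (simp only: borel_prod measurable_fibre_map2)

lemma fibre_props: "prob_space (fibre y)" "sets (fibre y) = sets borel" "space (fibre y) = UNIV"
  using measurable_space[OF fibre, of y] by (auto simp: space_prob_algebra fibre_def)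

lemma nn_integral_fibre:
  "f \<in> borel_measurable borel \<Longrightarrow> (\<integral>\<^sup>+u. f u \<partial>fibre y) = (\<integral>\<^sup>+\<omega>. f (y, past (Z_path \<omega>)) \<partial>Py y)"
  unfolding fibre_def using measurable_fibre_map by (intro nn_integral_distr) (simp_all add: measurable_Py)

definition Y_law :: "(int \<Rightarrow> 'f) measure" where
  "Y_law = distr P borel Y_path"

lemma prob_Y_law: "prob_space Y_law"
  unfolding Y_law_def by (intro law.prob_space_distr) (simp add: measurable_P)

lemma Y_law_props: "sets Y_law = sets borel" "space Y_law = UNIV" "measurable Y_law N = measurable borel N"
  by (auto simp: Y_law_def intro: measurable_cong_sets)

lemma nn_integral_Y_law:
  "f \<in> borel_measurable borel \<Longrightarrow> (\<integral>\<^sup>+y. f y \<partial>Y_law) = (\<integral>\<^sup>+\<omega>. f (Y_path \<omega>) \<partial>P)"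
  unfolding Y_law_def by (intro nn_integral_distr) (simp_all add: measurable_P)

lemma fibre_observed:
  assumes f: "f \<in> borel_measurable borel"
  shows "(\<integral>\<^sup>+y. \<integral>\<^sup>+u. f (y, u) \<partial>fibre y \<partial>Y_law) = (\<integral>\<^sup>+\<omega>. f (Y_path \<omega>, observed \<omega>) \<partial>P)"
proof -
  have fy: "(\<lambda>u. f (y, u)) \<in> borel_measurable borel" for y
    by (rule measurable_compose[OF _ f]) (intro borel_measurable_Pair, auto)
  have f': "case_prod (\<lambda>y u. f (y, u)) \<in> borel_measurable (borel \<Otimes>\<^sub>M borel)"
    using f by (simp add: borel_prod)
  have m: "(\<lambda>y. \<integral>\<^sup>+u. f (y, u) \<partial>fibre y) \<in> borel_measurable borel"
    using nn_integral_measurable_subprob_algebra2[OF f' measurable_prob_algebraD[OF fibre]] .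
  have "(\<integral>\<^sup>+y. \<integral>\<^sup>+u. f (y, u) \<partial>fibre y \<partial>Y_law) = (\<integral>\<^sup>+\<omega>. \<integral>\<^sup>+u. f (Y_path \<omega>, u) \<partial>fibre (Y_path \<omega>) \<partial>P)"
    by (rule nn_integral_Y_law[OF m])
  also have "\<dots> = (\<integral>\<^sup>+\<omega>. \<integral>\<^sup>+\<omega>'. f (Y_path \<omega>, Y_path \<omega>, past (Z_path \<omega>')) \<partial>Py (Y_path \<omega>) \<partial>P)"
    by (intro nn_integral_cong nn_integral_fibre fy)
  also have "\<dots> = (\<integral>\<^sup>+\<omega>. f (Y_path \<omega>, Y_path \<omega>, past (Z_path \<omega>)) \<partial>P)"
  proof (rule Y_disintegration[where f="\<lambda>(y, \<omega>'). f (y, y, past (Z_path \<omega>'))", simplified])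
    show "(\<lambda>(y, \<omega>'). f (y, y, past (Z_path (\<omega>' :: ('g, 'f) path)))) \<in> borel_measurable borel"
      using measurable_compose[OF borel_measurable_Pair[OF borel_measurable_fst measurable_fibre_map2] f]
      by (simp add: split_beta)
  qed
  finally show ?thesis by (simp add: observed_def)
qed

text \<open>
  Given the environment, moving the information by \<open>n\<close> steps amounts to shifting the environment. Both
  sides are kernels in \<open>y\<close>, and by stationarity both have the mean
  \<open>P (observed \<circ> shift n \<in> A, Y \<in> B)\<close>.
\<close>

lemma fibre_step_at: "AE y in Y_law. fibre y \<bind> step n = fibre (shift (int n) y)"
proof -
  interpret Y: prob_space Y_law by (rule prob_Y_law)
  have l: "(\<lambda>y. fibre y \<bind> step n) \<in> borel \<rightarrow>\<^sub>M prob_algebra borel"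
    by (rule measurable_bind_prob_space[OF fibre step])
  have r: "(\<lambda>y. fibre (shift (int n) y)) \<in> borel \<rightarrow>\<^sub>M prob_algebra borel"
    by (rule measurable_compose[OF measurable_shift fibre])
  show ?thesis
  proof (rule Y.kernel_AE_eq)
    show "(\<lambda>y. fibre y \<bind> step n) \<in> Y_law \<rightarrow>\<^sub>M prob_algebra borel"
      "(\<lambda>y. fibre (shift (int n) y)) \<in> Y_law \<rightarrow>\<^sub>M prob_algebra borel"
      using l r by (simp_all add: Y_law_props)
    fix A :: "((int \<Rightarrow> 'f) \<times> (nat \<Rightarrow> 'g)) set" and B :: "(int \<Rightarrow> 'f) set"
    assume A: "A \<in> sets borel" and "B \<in> sets Y_law"
    then have B: "B \<in> sets borel" by (simp add: Y_law_props)
    have ind: "(indicator A :: _ \<Rightarrow> ennreal) \<in> borel_measurable borel" "(indicator B :: _ \<Rightarrow> ennreal) \<in> borel_measurable borel"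
      using A B by auto
    have step_m: "(\<lambda>u. emeasure (step n u) A) \<in> borel_measurable borel"
      using step A by (rule measurable_emeasure_kernel)
    have "(\<integral>\<^sup>+y. emeasure (fibre y \<bind> step n) A * indicator B y \<partial>Y_law)
        = (\<integral>\<^sup>+y. \<integral>\<^sup>+u. emeasure (step n u) A * indicator B y \<partial>fibre y \<partial>Y_law)"
    proof (rule nn_integral_cong)
      fix y
      have f: "fibre y \<in> space (prob_algebra borel)"
        using fibre_props by (auto simp: space_prob_algebra)
      have "(\<lambda>u. emeasure (step n u) A) \<in> borel_measurable (fibre y)"
        using step_m fibre_props(2)[of y] by (simp cong: measurable_cong_sets)
      then show "emeasure (fibre y \<bind> step n) A * indicator B y = (\<integral>\<^sup>+u. emeasure (step n u) A * indicator B y \<partial>fibre y)"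
        by (simp add: emeasure_bind_prob_algebra[OF f step A] nn_integral_multc)
    qed
    also have "\<dots> = (\<integral>\<^sup>+\<omega>. emeasure (step n (observed \<omega>)) A * indicator B (Y_path \<omega>) \<partial>P)"
      by (rule fibre_observed[where f="\<lambda>(y, u). emeasure (step n u) A * indicator B y", simplified], unfold split_beta)
        (intro borel_measurable_times_ennreal measurable_compose[OF borel_measurable_fst ind(2)]
          measurable_compose[OF borel_measurable_snd step_m])
    also have "\<dots> = (\<integral>\<^sup>+\<omega>. \<integral>\<^sup>+\<omega>'. indicator A (observed (shift (int n) \<omega>')) * indicator B (fst (observed \<omega>)) \<partial>K (observed \<omega>) \<partial>P)"
    proof (rule nn_integral_cong)
      fix \<omega>
      have m: "(\<lambda>\<omega>'. indicator A (observed (shift (int n) \<omega>')) :: ennreal) \<in> borel_measurable (K (observed \<omega>))"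
        using measurable_compose[OF observed_shift ind(1)] by (simp add: measurable_K)
      have "emeasure (step n (observed \<omega>)) A = (\<integral>\<^sup>+u. indicator A u \<partial>step n (observed \<omega>))"
        using A by (simp add: step_props)
      also have "\<dots> = (\<integral>\<^sup>+\<omega>'. indicator A (observed (shift (int n) \<omega>')) \<partial>K (observed \<omega>))"
        unfolding step_def using A observed_shift by (intro nn_integral_distr) (simp_all add: measurable_K)
      finally show "emeasure (step n (observed \<omega>)) A * indicator B (Y_path \<omega>)
          = (\<integral>\<^sup>+\<omega>'. indicator A (observed (shift (int n) \<omega>')) * indicator B (fst (observed \<omega>)) \<partial>K (observed \<omega>))"
        using m by (simp add: nn_integral_multc observed_def)
    qed
    also have "\<dots> = (\<integral>\<^sup>+\<omega>. indicator A (observed (shift (int n) \<omega>)) * indicator B (fst (observed \<omega>)) \<partial>P)"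
      by (rule observed_disintegration[where f="\<lambda>(x, \<omega>'). indicator A (observed (shift (int n) \<omega>')) * indicator B (fst x)", simplified], unfold split_beta)
        (intro borel_measurable_times_ennreal measurable_compose[OF borel_measurable_fst measurable_compose[OF borel_measurable_fst ind(2)]]
          measurable_compose[OF borel_measurable_snd measurable_compose[OF observed_shift ind(1)]])
    also have "\<dots> = (\<integral>\<^sup>+\<omega>. indicator A (observed (shift (int n) \<omega>)) * indicator B (shift (- int n) (Y_path (shift (int n) \<omega>))) \<partial>P)"
      by (simp add: Y_path_shift observed_def)
    also have "\<dots> = (\<integral>\<^sup>+\<omega>. indicator A (observed \<omega>) * indicator B (shift (- int n) (Y_path \<omega>)) \<partial>P)"
      by (rule nn_integral_shift[where f="\<lambda>\<omega>. indicator A (observed \<omega>) * indicator B (shift (- int n) (Y_path \<omega>))"])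
        (intro borel_measurable_times_ennreal measurable_compose[OF measurable_observed ind(1)]
          measurable_compose[OF measurable_Y_path measurable_compose[OF measurable_shift ind(2)]])
    also have "\<dots> = (\<integral>\<^sup>+y. \<integral>\<^sup>+u. indicator A u * indicator B (shift (- int n) y) \<partial>fibre y \<partial>Y_law)"
      by (rule fibre_observed[where f="\<lambda>(y, u). indicator A u * indicator B (shift (- int n) y)", simplified, symmetric], unfold split_beta)
        (intro borel_measurable_times_ennreal measurable_compose[OF borel_measurable_fst measurable_compose[OF measurable_shift ind(2)]]
          measurable_compose[OF borel_measurable_snd ind(1)])
    also have "\<dots> = (\<integral>\<^sup>+y. emeasure (fibre y) A * indicator B (shift (- int n) y) \<partial>Y_law)"
      using A by (intro nn_integral_cong) (subst nn_integral_multc, auto simp: fibre_props intro!: borel_measurable_indicator)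
    also have "\<dots> = (\<integral>\<^sup>+y. emeasure (fibre (shift (int n) y)) A * indicator B y \<partial>Y_law)"
    proof -
      have f_m: "(\<lambda>y. emeasure (fibre y) A) \<in> borel_measurable borel"
        using fibre A by (rule measurable_emeasure_kernel)
      have m: "(\<lambda>y. emeasure (fibre y) A * indicator B (shift (- int n) y)) \<in> borel_measurable borel"
        "(\<lambda>y. emeasure (fibre (shift (int n) y)) A * indicator B y) \<in> borel_measurable borel"
        by (intro borel_measurable_times_ennreal f_m ind measurable_compose[OF measurable_shift ind(2)]
            measurable_compose[OF measurable_shift f_m])+
      show ?thesis
        unfolding nn_integral_Y_law[OF m(1)] nn_integral_Y_law[OF m(2)]
        using nn_integral_shift[OF measurable_compose[OF measurable_Y_path m(1)], of "int n"]
        by (simp add: Y_path_shift)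
    qed
    finally show "(\<integral>\<^sup>+y. emeasure (fibre y \<bind> step n) A * indicator B y \<partial>Y_law)
        = (\<integral>\<^sup>+y. emeasure (fibre (shift (int n) y)) A * indicator B y \<partial>Y_law)" .
  qed
qed

text \<open>
  The law of the two pasts under the coupling; see \<open>distr_coupling\<close>.
\<close>

definition pair_law ::
    "(((int \<Rightarrow> 'f) \<times> (nat \<Rightarrow> 'g)) \<times> ((int \<Rightarrow> 'f) \<times> (nat \<Rightarrow> 'g))) measure" where
  "pair_law = Y_law \<bind> (\<lambda>y. fibre y \<Otimes>\<^sub>M fibre y)"

lemma fibre_pair: "(\<lambda>y. fibre y \<Otimes>\<^sub>M fibre y) \<in> borel \<rightarrow>\<^sub>M prob_algebra (borel \<Otimes>\<^sub>M borel)"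
  by (intro measurable_pair_prob fibre)

lemma Y_law_in_prob_algebra: "Y_law \<in> space (prob_algebra borel)"
  using prob_Y_law by (simp add: space_prob_algebra Y_law_props)

lemma prob_pair_law: "prob_space pair_law" and sets_pair_law: "sets pair_law = sets (borel \<Otimes>\<^sub>M borel)"
proof -
  have "(\<lambda>_::unit. Y_law) \<in> count_space UNIV \<rightarrow>\<^sub>M prob_algebra borel" using Y_law_in_prob_algebra by simp
  from measurable_space[OF measurable_bind_prob_space[OF this fibre_pair], of "()"]
  show "prob_space pair_law" "sets pair_law = sets (borel \<Otimes>\<^sub>M borel)"
    by (auto simp: pair_law_def space_prob_algebra)
qed

lemma nn_integral_pair_law_times:
  assumes f: "f \<in> borel_measurable borel" and g: "g \<in> borel_measurable borel"
  shows "(\<integral>\<^sup>+(x, x'). f x * g x' \<partial>pair_law) = (\<integral>\<^sup>+y. (\<integral>\<^sup>+x. f x \<partial>fibre y) * (\<integral>\<^sup>+x. g x \<partial>fibre y) \<partial>Y_law)"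
proof -
  have fg: "(\<lambda>(x, x'). f x * g x') \<in> borel_measurable (borel \<Otimes>\<^sub>M borel)"
    using f g by measurable
  have "(\<integral>\<^sup>+(x, x'). f x * g x' \<partial>pair_law) = (\<integral>\<^sup>+y. \<integral>\<^sup>+(x, x'). f x * g x' \<partial>(fibre y \<Otimes>\<^sub>M fibre y) \<partial>Y_law)"
    unfolding pair_law_def using measurable_prob_algebraD[OF fibre_pair]
    by (intro nn_integral_bind[OF fg]) (simp add: Y_law_props)
  also have "\<dots> = (\<integral>\<^sup>+y. (\<integral>\<^sup>+x. f x \<partial>fibre y) * (\<integral>\<^sup>+x. g x \<partial>fibre y) \<partial>Y_law)"
  proof (rule nn_integral_cong)
    fix y
    interpret F: prob_space "fibre y" by (rule fibre_props)
    have fy: "f \<in> borel_measurable (fibre y)" "g \<in> borel_measurable (fibre y)"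
      using f g fibre_props(2)[of y] by (simp_all cong: measurable_cong_sets)
    have "(\<integral>\<^sup>+(x, x'). f x * g x' \<partial>(fibre y \<Otimes>\<^sub>M fibre y)) = (\<integral>\<^sup>+x. \<integral>\<^sup>+x'. f x * g x' \<partial>fibre y \<partial>fibre y)"
      using fy by (subst F.nn_integral_fst[symmetric]) auto
    also have "\<dots> = (\<integral>\<^sup>+x. f x \<partial>fibre y) * (\<integral>\<^sup>+x. g x \<partial>fibre y)"
      using fy by (simp add: nn_integral_cmult nn_integral_multc)
    finally show "(\<integral>\<^sup>+(x, x'). f x * g x' \<partial>(fibre y \<Otimes>\<^sub>M fibre y)) = (\<integral>\<^sup>+x. f x \<partial>fibre y) * (\<integral>\<^sup>+x. g x \<partial>fibre y)" .
  qed
  finally show ?thesis .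
qed

lemma emeasure_pair_law_Times:
  assumes "A \<in> sets borel" "B \<in> sets borel"
  shows "emeasure pair_law (A \<times> B) = (\<integral>\<^sup>+y. emeasure (fibre y) A * emeasure (fibre y) B \<partial>Y_law)"
proof -
  have "emeasure pair_law (A \<times> B) = (\<integral>\<^sup>+u. indicator (A \<times> B) u \<partial>pair_law)"
    using assms by (simp add: sets_pair_law)
  also have "\<dots> = (\<integral>\<^sup>+(x, x'). indicator A x * indicator B x' \<partial>pair_law)"
    by (intro nn_integral_cong) (auto simp: indicator_def)
  finally show ?thesis
    using assms by (simp add: nn_integral_pair_law_times fibre_props)
qed

definition pair_step where
  "pair_step n = (\<lambda>(x, x'). step n x \<Otimes>\<^sub>M step n x')"

lemma pair_step: "pair_step n \<in> borel \<Otimes>\<^sub>M borel \<rightarrow>\<^sub>M prob_algebra (borel \<Otimes>\<^sub>M borel)"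
  unfolding pair_step_def split_beta
  by (intro measurable_pair_prob measurable_compose[OF measurable_fst step] measurable_compose[OF measurable_snd step])

text \<open>
  Given \<open>y\<close>, the two coordinates are independent and each has its law moved from \<open>fibre y\<close> to
  \<open>fibre (shift n y)\<close>; the law of the environment does not notice the shift. It suffices to check
  rectangles, on which both measures factorize over \<open>y\<close>.
\<close>

lemma pair_law_invariant: "pair_law \<bind> pair_step n = pair_law"
proof (rule prob_measure_eq_on_rectangles[OF prob_pair_law sets_pair_law, symmetric])
  have p: "pair_law \<in> space (prob_algebra (borel \<Otimes>\<^sub>M borel))"
    using prob_pair_law sets_pair_law by (simp add: space_prob_algebra)
  have "(\<lambda>_::unit. pair_law) \<in> count_space UNIV \<rightarrow>\<^sub>M prob_algebra (borel \<Otimes>\<^sub>M borel)" using p by simp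
  from measurable_space[OF measurable_bind_prob_space[OF this pair_step], of "()"]
  show "sets (pair_law \<bind> pair_step n) = sets (borel \<Otimes>\<^sub>M borel)"
    by (auto simp: space_prob_algebra)
  fix A B :: "((int \<Rightarrow> 'f) \<times> (nat \<Rightarrow> 'g)) set"
  assume A: "A \<in> sets borel" and B: "B \<in> sets borel"
  have AB: "A \<times> B \<in> sets (borel \<Otimes>\<^sub>M borel)" using A B by simp
  have "emeasure (pair_law \<bind> pair_step n) (A \<times> B) = (\<integral>\<^sup>+u. emeasure (pair_step n u) (A \<times> B) \<partial>pair_law)"
    by (rule emeasure_bind_prob_algebra[OF p pair_step AB])
  also have "\<dots> = (\<integral>\<^sup>+(x, x'). emeasure (step n x) A * emeasure (step n x') B \<partial>pair_law)"
  proof (intro nn_integral_cong, clarify)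
    fix x x'
    interpret S: prob_space "step n x'" by (rule step_props)
    show "emeasure (pair_step n (x, x')) (A \<times> B) = emeasure (step n x) A * emeasure (step n x') B"
      using A B by (simp add: pair_step_def S.emeasure_pair_measure_Times step_props)
  qed
  also have "\<dots> = (\<integral>\<^sup>+y. (\<integral>\<^sup>+x. emeasure (step n x) A \<partial>fibre y) * (\<integral>\<^sup>+x. emeasure (step n x) B \<partial>fibre y) \<partial>Y_law)"
    using A B by (intro nn_integral_pair_law_times measurable_emeasure_kernel[OF step])
  also have "\<dots> = (\<integral>\<^sup>+y. emeasure (fibre y \<bind> step n) A * emeasure (fibre y \<bind> step n) B \<partial>Y_law)"
    using fibre_props A B
    by (intro nn_integral_cong) (simp add: emeasure_bind_prob_algebra[OF _ step] space_prob_algebra)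
  also have "\<dots> = (\<integral>\<^sup>+y. emeasure (fibre (shift (int n) y)) A * emeasure (fibre (shift (int n) y)) B \<partial>Y_law)"
    using fibre_step_at[of n] by (intro nn_integral_cong_AE) (auto elim: eventually_mono)
  also have "\<dots> = (\<integral>\<^sup>+y. emeasure (fibre y) A * emeasure (fibre y) B \<partial>Y_law)"
  proof -
    have m: "(\<lambda>y. emeasure (fibre y) A * emeasure (fibre y) B) \<in> borel_measurable borel"
      by (intro borel_measurable_times_ennreal measurable_emeasure_kernel[OF fibre] A B)
    show ?thesis
      unfolding nn_integral_Y_law[OF m] nn_integral_Y_law[OF measurable_compose[OF measurable_shift m]]
      using nn_integral_shift[OF measurable_compose[OF measurable_Y_path m], of "int n"]
      by (simp add: Y_path_shift)
  qed
  finally show "emeasure pair_law (A \<times> B) = emeasure (pair_law \<bind> pair_step n) (A \<times> B)"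
    by (simp add: emeasure_pair_law_Times[OF A B])
qed

end

section \<open>The tail field\<close>

lemma sigma_algebra_F_Z: "sigma_algebra UNIV (sets (F_Z I))"
  using sets.sigma_algebra_axioms[of "F_Z I"] by simp

text \<open>
  The future of \<open>Z\<close> is generated by a single variable with values in a Polish space, as
  \<open>measurable_tv_on_vimage\<close> requires.
\<close>

lemma sets_F_Z_vimage:
  "sets (F_Z {int n..} :: ('g::second_countable_topology, 'f) path measure)
    = {(\<lambda>\<omega> k::nat. Z_coord (int n + int k) \<omega>) -` B | B. B \<in> sets borel}"
    (is "sets (F_Z ?I :: ('g, 'f) path measure) = {?W -` B | B. B \<in> sets borel}")
proof
  let ?V = "vimage_algebra UNIV ?W borel :: ('g, 'f) path measure"
  have V: "sets ?V = {?W -` B | B. B \<in> sets borel}" by (simp add: sets_vimage_algebra2)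
  have "Z_coord k \<in> ?V \<rightarrow>\<^sub>M borel" if "k \<in> ?I" for k
  proof -
    have "(\<lambda>\<omega>. ?W \<omega> (nat (k - int n))) \<in> ?V \<rightarrow>\<^sub>M borel"
      by (intro measurable_compose[OF measurable_vimage_algebra1 measurable_product_coordinates]) auto
    then show ?thesis using that by simp
  qed
  then show "sets (F_Z ?I :: ('g, 'f) path measure) \<subseteq> {?W -` B | B. B \<in> sets borel}"
    using sets_field_of_subset[of ?I Z_coord ?V] V by auto
  have "?W \<in> F_Z ?I \<rightarrow>\<^sub>M borel"
    by (intro measurable_coordinatewise_then_product measurable_field_of) auto
  from measurable_sets[OF this] show "{?W -` B | B. B \<in> sets borel} \<subseteq> sets (F_Z ?I :: ('g, 'f) path measure)"
    by auto
qed

lemma sets_F_Z_borel: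
  "sets (F_Z I) \<subseteq> sets (borel :: ('g::second_countable_topology, 'f::second_countable_topology) path measure)"
  by (rule sets_field_of_subset) auto

lemma decseq_F_Z: "decseq (\<lambda>n::nat. sets (F_Z {int n..} :: ('g::topological_space, 'f) path measure))"
proof (rule decseq_SucI)
  show "sets (F_Z {int (Suc n)..}) \<subseteq> sets (F_Z {int n..} :: ('g, 'f) path measure)" for n
    by (rule sets_field_of_subset) (auto intro: measurable_field_of)
qed

lemma tail_Z_sets:
  "A \<in> tail_Z \<Longrightarrow> A \<in> sets (borel :: ('g::second_countable_topology, 'f::second_countable_topology) path measure)"
  using sets_F_Z_borel unfolding tail_Z_def by blast

text \<open>
  The tail field is invariant under shifts, also backwards: an event from time \<open>m + n\<close> on is the shift by
  \<open>n\<close> of an event from time \<open>m\<close> on.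
\<close>

lemma tail_Z_shift:
  fixes A :: "('g::topological_space, 'f) path set"
  assumes "A \<in> tail_Z"
  obtains A' where "A' \<in> tail_Z" "A = shift (int n) -` A'"
proof
  have "shift (- int n) -` A \<in> sets (F_Z {int m..})" for m
  proof -
    have sh: "shift (- int n) \<in> (F_Z {int m..} :: ('g, 'f) path measure) \<rightarrow>\<^sub>M F_Z {int (m + n)..}"
      unfolding field_of_def[of Z_coord "{int (m + n)..}"]
    proof (rule measurable_sigma_sets)
      show "sets (sigma UNIV {Z_coord k -` B |k B. k \<in> {int (m + n)..} \<and> B \<in> sets borel})
        = sigma_sets UNIV {Z_coord k -` B |k B. k \<in> {int (m + n)..} \<and> B \<in> sets (borel :: 'g measure)}"
        by (rule sets_measure_of) simp
      fix V :: "('g, 'f) path set" assume "V \<in> {Z_coord k -` B |k B. k \<in> {int (m + n)..} \<and> B \<in> sets borel}"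
      then obtain k B where V: "V = Z_coord k -` B" "k \<ge> int (m + n)" "B \<in> sets borel" by auto
      have "shift (- int n) -` V \<inter> space (F_Z {int m..}) = Z_coord (k - int n) -` B \<inter> space (F_Z {int m..} :: ('g, 'f) path measure)"
        using V by (auto simp: Z_coord_def shift_def)
      also have "\<dots> \<in> sets (F_Z {int m..})"
        using V by (intro measurable_sets[OF measurable_field_of]) auto
      finally show "shift (- int n) -` V \<inter> space (F_Z {int m..}) \<in> sets (F_Z {int m..} :: ('g, 'f) path measure)" .
    qed auto
    have "A \<in> sets (F_Z {int (m + n)..})"
      using assms by (auto simp: tail_Z_def simp del: of_nat_add)
    from measurable_sets[OF sh this] show ?thesis by simp
  qed
  then show "shift (- int n) -` A \<in> tail_Z" by (auto simp: tail_Z_def)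
  show "A = shift (int n) -` (shift (- int n) -` A)" by auto
qed

section \<open>The coupling seen through the pasts\<close>

context conditioned_process
begin

text \<open>
  Both marginals of \<open>pair_law\<close> are the law of the information under \<open>P\<close>.
\<close>

lemma AE_pair_law:
  assumes "AE x in observed_law. G x"
  shows "AE (x, x') in pair_law. G x \<and> G x'"
proof -
  have m: "measurable pair_law N = measurable (borel \<Otimes>\<^sub>M borel) N" for N :: "'c measure"
    by (rule measurable_cong_sets[OF sets_pair_law refl])
  have sp: "space pair_law = UNIV"
    using sets_eq_imp_space_eq[OF sets_pair_law] by (simp add: space_pair_measure)
  have marg: "(\<integral>\<^sup>+y. emeasure (fibre y) A \<partial>Y_law) = emeasure observed_law A" if A: "A \<in> sets borel" for A
  proof -
    have "(\<integral>\<^sup>+y. emeasure (fibre y) A \<partial>Y_law) = (\<integral>\<^sup>+y. \<integral>\<^sup>+u. indicator A u \<partial>fibre y \<partial>Y_law)"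
      using A by (simp add: fibre_props)
    also have "\<dots> = (\<integral>\<^sup>+\<omega>. indicator A (observed \<omega>) \<partial>P)"
      using A by (intro fibre_observed[where f="\<lambda>(y, u). indicator A u", simplified], unfold split_beta)
        (intro measurable_compose[OF borel_measurable_snd], simp)
    also have "\<dots> = emeasure observed_law A"
      using A by (simp add: nn_integral_observed_law[symmetric]) (simp add: observed_law_def)
    finally show ?thesis .
  qed
  have dfst: "distr pair_law borel fst = observed_law"
  proof (rule measure_eqI)
    fix A assume "A \<in> sets (distr pair_law borel fst)"
    then have A: "A \<in> sets borel" by simp
    have "emeasure (distr pair_law borel fst) A = emeasure pair_law (A \<times> UNIV)"
      using A by (subst emeasure_distr) (auto simp: m sp intro!: arg_cong[where f="emeasure pair_law"])
    also have "\<dots> = emeasure observed_law A"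
      using A marg[OF A] prob_space.emeasure_space_1[OF fibre_props(1)]
      by (simp add: emeasure_pair_law_Times fibre_props)
    finally show "emeasure (distr pair_law borel fst) A = emeasure observed_law A" .
  qed (simp add: observed_law_def)
  have dsnd: "distr pair_law borel snd = observed_law"
  proof (rule measure_eqI)
    fix A assume "A \<in> sets (distr pair_law borel snd)"
    then have A: "A \<in> sets borel" by simp
    have "emeasure (distr pair_law borel snd) A = emeasure pair_law (UNIV \<times> A)"
      using A by (subst emeasure_distr) (auto simp: m sp intro!: arg_cong[where f="emeasure pair_law"])
    also have "\<dots> = emeasure observed_law A"
      using A marg[OF A] prob_space.emeasure_space_1[OF fibre_props(1)]
      by (simp add: emeasure_pair_law_Times fibre_props)
    finally show "emeasure (distr pair_law borel snd) A = emeasure observed_law A" .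
  qed (simp add: observed_law_def)
  have "fst \<in> pair_law \<rightarrow>\<^sub>M borel" "snd \<in> pair_law \<rightarrow>\<^sub>M borel" by (simp_all add: m)
  from this[THEN AE_distrD] assms have "AE u in pair_law. G (fst u)" "AE u in pair_law. G (snd u)"
    unfolding dfst dsnd by blast+
  then show ?thesis by eventually_elim auto
qed

lemma sets_coupling: "sets (coupling P Py) = sets borel"
proof -
  have "space (distr (Py y) borel Z_path) \<noteq> {}" "space (distr P borel Y_path) \<noteq> {}" for y by auto
  then show ?thesis unfolding coupling_def by (intro sets_bind) auto
qed

lemma distr_coupling:
  defines "pasts \<equiv> \<lambda>(z, z', y). ((y :: int \<Rightarrow> 'f, past (z :: int \<Rightarrow> 'g)), (y, past z'))"
  shows "pasts \<in> coupling P Py \<rightarrow>\<^sub>M borel \<Otimes>\<^sub>M borel" and "distr (coupling P Py) (borel \<Otimes>\<^sub>M borel) pasts = pair_law"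
proof -
  have y: "(\<lambda>w::(int \<Rightarrow> 'g) \<times> (int \<Rightarrow> 'g) \<times> (int \<Rightarrow> 'f). snd (snd w)) \<in> borel \<rightarrow>\<^sub>M borel"
    by (rule measurable_compose[OF borel_measurable_snd borel_measurable_snd])
  have z': "(\<lambda>w::(int \<Rightarrow> 'g) \<times> (int \<Rightarrow> 'g) \<times> (int \<Rightarrow> 'f). past (fst (snd w))) \<in> borel \<rightarrow>\<^sub>M borel"
    by (rule measurable_compose[OF borel_measurable_snd measurable_compose[OF borel_measurable_fst measurable_past]])
  have z: "(\<lambda>w::(int \<Rightarrow> 'g) \<times> (int \<Rightarrow> 'g) \<times> (int \<Rightarrow> 'f). past (fst w)) \<in> borel \<rightarrow>\<^sub>M borel"
    by (rule measurable_compose[OF borel_measurable_fst measurable_past])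
  have pm: "pasts \<in> borel \<rightarrow>\<^sub>M borel \<Otimes>\<^sub>M borel"
    unfolding pasts_def split_beta by (intro measurable_Pair borel_measurable_Pair y z z')
  show p: "pasts \<in> coupling P Py \<rightarrow>\<^sub>M borel \<Otimes>\<^sub>M borel"
    using pm sets_coupling by (simp cong: measurable_cong_sets)
  have sp: "space (coupling P Py) = UNIV" using sets_eq_imp_space_eq[OF sets_coupling] by simp
  have Py': "Py \<in> borel \<rightarrow>\<^sub>M prob_algebra P"
    using rcp_Py by (simp add: regular_cond_prob_def)
  show "distr (coupling P Py) (borel \<Otimes>\<^sub>M borel) pasts = pair_law"
  proof (rule prob_measure_eq_on_rectangles[OF prob_pair_law sets_pair_law, symmetric])
    fix A B :: "((int \<Rightarrow> 'f) \<times> (nat \<Rightarrow> 'g)) set"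
    assume A: "A \<in> sets borel" and B: "B \<in> sets borel"
    have slice: "(\<integral>\<^sup>+z. indicator C (y, past z) \<partial>distr (Py y) borel Z_path) = emeasure (fibre y) C"
      "(\<lambda>z. indicator C (y, past z) :: ennreal) \<in> borel_measurable (distr (Py y) borel Z_path)"
      if C: "C \<in> sets borel" for C :: "((int \<Rightarrow> 'f) \<times> (nat \<Rightarrow> 'g)) set" and y
    proof -
      have iC: "(indicator C :: _ \<Rightarrow> ennreal) \<in> borel_measurable borel" using C by simp
      have m: "(\<lambda>z. indicator C (y, past z) :: ennreal) \<in> borel_measurable borel"
        by (intro measurable_compose[OF _ iC] borel_measurable_Pair measurable_past) simp
      then show "(\<lambda>z. indicator C (y, past z) :: ennreal) \<in> borel_measurable (distr (Py y) borel Z_path)"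
        by simp
      have "(\<integral>\<^sup>+z. indicator C (y, past z) \<partial>distr (Py y) borel Z_path) = (\<integral>\<^sup>+\<omega>. indicator C (y, past (Z_path \<omega>)) \<partial>Py y)"
        using m by (intro nn_integral_distr) (simp_all add: measurable_Py)
      also have "\<dots> = emeasure (fibre y) C"
        using C by (simp add: nn_integral_fibre[symmetric] fibre_props)
      finally show "(\<integral>\<^sup>+z. indicator C (y, past z) \<partial>distr (Py y) borel Z_path) = emeasure (fibre y) C" .
    qed
    have vB: "pasts -` (A \<times> B) \<in> sets borel"
      using measurable_sets[OF pm, of "A \<times> B"] A B by simp
    have "emeasure (distr (coupling P Py) (borel \<Otimes>\<^sub>M borel) pasts) (A \<times> B) = emeasure (coupling P Py) (pasts -` (A \<times> B))"
      using p A B by (subst emeasure_distr) (auto simp: sp)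
    also have "\<dots> = (\<integral>\<^sup>+y. \<integral>\<^sup>+z. \<integral>\<^sup>+z'. indicator (pasts -` (A \<times> B)) (z, z', y)
        \<partial>distr (Py y) borel Z_path \<partial>distr (Py y) borel Z_path \<partial>Y_law)"
      unfolding Y_law_def by (rule emeasure_coupling[OF prob_P sets_P Py' vB])
    also have "\<dots> = (\<integral>\<^sup>+y. emeasure (fibre y) A * emeasure (fibre y) B \<partial>Y_law)"
    proof (rule nn_integral_cong)
      fix y
      have "(\<integral>\<^sup>+z. \<integral>\<^sup>+z'. indicator (pasts -` (A \<times> B)) (z, z', y) \<partial>distr (Py y) borel Z_path \<partial>distr (Py y) borel Z_path)
          = (\<integral>\<^sup>+z. \<integral>\<^sup>+z'. indicator A (y, past z) * indicator B (y, past z') \<partial>distr (Py y) borel Z_path \<partial>distr (Py y) borel Z_path)"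
        by (intro nn_integral_cong) (auto simp: pasts_def indicator_def)
      also have "\<dots> = emeasure (fibre y) A * emeasure (fibre y) B"
        using slice[OF A] slice[OF B] by (simp add: nn_integral_cmult nn_integral_multc)
      finally show "(\<integral>\<^sup>+z. \<integral>\<^sup>+z'. indicator (pasts -` (A \<times> B)) (z, z', y) \<partial>distr (Py y) borel Z_path \<partial>distr (Py y) borel Z_path)
          = emeasure (fibre y) A * emeasure (fibre y) B" .
    qed
    finally show "emeasure pair_law (A \<times> B) = emeasure (distr (coupling P Py) (borel \<Otimes>\<^sub>M borel) pasts) (A \<times> B)"
      by (simp add: emeasure_pair_law_Times[OF A B])
  qed simp
qed

text \<open>
  Transfer from the pasts to the coupling goes through an almost sure statement about an image
  measure, so that \<open>R\<close> may be any predicate, measurable or not.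
\<close>

lemma AE_coupling:
  assumes "AE (x, x') in pair_law. R x x'"
  shows "AE (z, z', y) in coupling P Py. R (y, past z) (y, past z')"
proof -
  have "AE w in coupling P Py. case (case w of (z, z', y) \<Rightarrow> ((y, past z), (y, past z'))) of (x, x') \<Rightarrow> R x x'"
    using assms unfolding distr_coupling(2)[symmetric] by (rule AE_distrD[OF distr_coupling(1)])
  then show ?thesis by eventually_elim auto
qed

section \<open>The tail distance along the pair chain\<close>

text \<open>
  The number \<open>\<beta>\<close> of the introduction.
\<close>

definition tail_distance where
  "tail_distance = (\<lambda>(x, x'). tv_on tail_Z (K x) (K x'))"

lemmas tv_on_F_Z = tv_on_decseq[OF sigma_algebra_F_Z decseq_F_Z K_props(1,3) _ K_props(1,3)]

lemma F_Z_K: "sets (F_Z I) \<subseteq> sets (K x)"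
  using sets_F_Z_borel by (simp add: K_props)

lemma tail_distance_attained:
  obtains D where "D \<in> tail_Z" "2 * (measure (K x) D - measure (K x') D) = tail_distance (x, x')"
  using tv_on_F_Z(1)[OF F_Z_K F_Z_K, of x x'] unfolding tail_distance_def tail_Z_def[symmetric] by auto

lemma tail_distance_limit:
  "(\<lambda>n. tv_on (sets (F_Z {int n..})) (K x) (K x')) \<longlonglongrightarrow> tail_distance (x, x')"
  using tv_on_F_Z(2)[OF F_Z_K F_Z_K, of x x'] unfolding tail_distance_def tail_Z_def[symmetric] by simp

lemma tail_distance_upper:
  "A \<in> tail_Z \<Longrightarrow> 2 * \<bar>measure (K x) A - measure (K x') A\<bar> \<le> tail_distance (x, x')"
  unfolding tail_distance_def by (simp add: tv_on_upper K_props)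

lemma tail_distance_bounds: "0 \<le> tail_distance u" "tail_distance u \<le> 2"
proof -
  have "{} \<in> (tail_Z :: ('g, 'f) path set set)" by (auto simp: tail_Z_def)
  then have "tail_Z \<noteq> ({} :: ('g, 'f) path set set)" by blast
  then show "0 \<le> tail_distance u" "tail_distance u \<le> 2"
    using tv_on_bounds[OF K_props(1) K_props(1)] by (auto simp: tail_distance_def split: prod.split)
qed

lemma measurable_tail_distance: "tail_distance \<in> borel_measurable (borel \<Otimes>\<^sub>M borel)"
proof (rule borel_measurable_LIMSEQ_real)
  show "(\<lambda>n. tv_on (sets (F_Z {int n..})) (K (fst u)) (K (snd u))) \<longlonglongrightarrow> tail_distance u" for u
    using tail_distance_limit[of "fst u" "snd u"] by simp
  show "(\<lambda>u. tv_on (sets (F_Z {int n..})) (K (fst u)) (K (snd u))) \<in> borel_measurable (borel \<Otimes>\<^sub>M borel)" for n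
    unfolding sets_F_Z_vimage
    by (intro measurable_tv_on_vimage measurable_coordinatewise_then_product measurable_Z_coord
        measurable_compose[OF measurable_fst K] measurable_compose[OF measurable_snd K])
qed

lemma pair_step_tail:
  fixes n :: nat
  assumes x: "Markov_from x" "Markov_from x'" and A': "A' \<in> sets borel"
  defines "A \<equiv> shift (int n) -` A'"
  shows "integrable (pair_step n (x, x')) (\<lambda>(u, u'). measure (K u) A' - measure (K u') A')"
    and "(\<integral>(u, u'). measure (K u) A' - measure (K u') A' \<partial>pair_step n (x, x')) = measure (K x) A - measure (K x') A"
    and "(\<integral>u. measure (K u) A' \<partial>step n x) = measure (K x) A"
proof -
  interpret S: prob_space "step n x" by (rule step_props)
  interpret S': prob_space "step n x'" by (rule step_props)
  interpret PP: pair_prob_space "step n x" "step n x'" ..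
  have le1: "measure (K u) A' \<le> 1" for u by (rule prob_space.prob_le_1[OF K_props(1)])
  have int: "integrable (step n v) (\<lambda>u. measure (K u) A')" for v
    using le1 by (intro integrable_step[of _ 1] measurable_measure_K A') auto
  have eq: "(\<integral>u. measure (K u) A' \<partial>step n v) = measure (K v) A" if "Markov_from v" for v
    using Markov_from_measure[OF that A', of UNIV n] by (simp add: A_def)
  show "(\<integral>u. measure (K u) A' \<partial>step n x) = measure (K x) A" using x(1) by (rule eq)
  have m: "(\<lambda>u. measure (K u) A') \<in> borel_measurable (step n v)" for v
    using measurable_measure_K[OF A'] step_props(2)[of n v] by (simp cong: measurable_cong_sets)
  have "(\<lambda>(u, u'). measure (K u) A' - measure (K u') A') \<in> borel_measurable (step n x \<Otimes>\<^sub>M step n x')"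
    unfolding split_beta
    by (intro borel_measurable_diff measurable_compose[OF measurable_fst m] measurable_compose[OF measurable_snd m])
  then have i: "integrable (step n x \<Otimes>\<^sub>M step n x') (\<lambda>(u, u'). measure (K u) A' - measure (K u') A')"
  proof (rule PP.P.integrable_const_bound[of _ 1, rotated])
    have "\<bar>measure (K u) A' - measure (K u') A'\<bar> \<le> 1" for u u'
      using le1[of u] le1[of u'] measure_nonneg[of "K u" A'] measure_nonneg[of "K u'" A'] by linarith
    then show "AE w in step n x \<Otimes>\<^sub>M step n x'. norm (case w of (u, u') \<Rightarrow> measure (K u) A' - measure (K u') A') \<le> 1"
      by auto
  qed
  then show "integrable (pair_step n (x, x')) (\<lambda>(u, u'). measure (K u) A' - measure (K u') A')"
    by (simp add: pair_step_def)
  have "(\<integral>(u, u'). measure (K u) A' - measure (K u') A' \<partial>pair_step n (x, x'))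
      = (\<integral>u. \<integral>u'. measure (K u) A' - measure (K u') A' \<partial>step n x' \<partial>step n x)"
    unfolding pair_step_def using PP.integral_fst'[OF i] by simp
  also have "\<dots> = measure (K x) A - measure (K x') A"
    using int by (simp add: S'.prob_space S.prob_space eq x)
  finally show "(\<integral>(u, u'). measure (K u) A' - measure (K u') A' \<partial>pair_step n (x, x')) = measure (K x) A - measure (K x') A" .
qed

lemma pair_step_props: "prob_space (pair_step n u)" "sets (pair_step n u) = sets (borel \<Otimes>\<^sub>M borel)"
  using measurable_space[OF pair_step, of u n] by (auto simp: space_prob_algebra space_pair_measure)

lemma integrable_tail_distance: "integrable (pair_step n u) tail_distance"
proof -
  interpret prob_space "pair_step n u" by (rule pair_step_props)
  show ?thesis
    using measurable_tail_distance tail_distance_bounds pair_step_props(2)[of n u]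
    by (intro integrable_const_bound[of _ 2]) (auto cong: measurable_cong_sets)
qed

text \<open>
  For an optimal tail event, the difference of its probabilities is the mean of the differences of the
  conditional probabilities at time \<open>n\<close>, each bounded by the distance there.
\<close>

lemma tail_distance_subharmonic:
  assumes "Markov_from x" "Markov_from x'"
  shows "tail_distance (x, x') \<le> (\<integral>u. tail_distance u \<partial>pair_step n (x, x'))"
proof -
  obtain D where D: "D \<in> tail_Z" "2 * (measure (K x) D - measure (K x') D) = tail_distance (x, x')"
    by (rule tail_distance_attained)
  obtain D' where D': "D' \<in> tail_Z" "D = shift (int n) -` D'"
    using D(1) by (rule tail_Z_shift)
  note ps = pair_step_tail[OF assms tail_Z_sets[OF D'(1)], of n, folded D'(2)]
  have "tail_distance (x, x') = (\<integral>w. 2 * (case w of (u, u') \<Rightarrow> measure (K u) D' - measure (K u') D') \<partial>pair_step n (x, x'))"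
    using ps D(2) by simp
  also have "\<dots> \<le> (\<integral>u. tail_distance u \<partial>pair_step n (x, x'))"
  proof (rule integral_mono[OF _ integrable_tail_distance])
    show "integrable (pair_step n (x, x')) (\<lambda>w. 2 * (case w of (u, u') \<Rightarrow> measure (K u) D' - measure (K u') D'))"
      using ps(1) by (rule integrable_mult_right)
    fix w :: "((int \<Rightarrow> 'f) \<times> (nat \<Rightarrow> 'g)) \<times> ((int \<Rightarrow> 'f) \<times> (nat \<Rightarrow> 'g))"
    obtain u u' where w: "w = (u, u')" by (cases w)
    have "2 * (measure (K u) D' - measure (K u') D') \<le> 2 * \<bar>measure (K u) D' - measure (K u') D'\<bar>"
      by (intro mult_left_mono abs_ge_self) simp
    also have "\<dots> \<le> tail_distance (u, u')" using D'(1) by (rule tail_distance_upper)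
    finally show "2 * (case w of (u, u') \<Rightarrow> measure (K u) D' - measure (K u') D') \<le> tail_distance w"
      by (simp add: w)
  qed
  finally show ?thesis .
qed

text \<open>
  The pairs of pasts from which the distance does not change along the pair chain. On these pairs
  the three conditions of the theorem are equivalent.
\<close>

definition rigid where
  "rigid x x' \<longleftrightarrow> Markov_from x \<and> Markov_from x' \<and>
    (\<forall>n. AE u in pair_step n (x, x'). tail_distance u = tail_distance (x, x'))"

lemma AE_rigid: "AE (x, x') in pair_law. rigid x x'"
proof -
  interpret Q: prob_space pair_law by (rule prob_pair_law)
  have M: "AE (x, x') in pair_law. Markov_from x \<and> Markov_from x'"
    by (rule AE_pair_law[OF AE_Markov_from])
  have "AE w in pair_law. AE u in pair_step n w. tail_distance u = tail_distance w" for n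
  proof (rule Q.subharmonic_constant[of _ _ 2])
    have "prob_algebra pair_law = prob_algebra (borel \<Otimes>\<^sub>M borel)"
      unfolding prob_algebra_def using subprob_algebra_cong[OF sets_pair_law] by simp
    then show "pair_step n \<in> pair_law \<rightarrow>\<^sub>M prob_algebra pair_law"
      using pair_step[of n] measurable_cong_sets[OF sets_pair_law refl] by auto
    show "tail_distance \<in> borel_measurable pair_law"
      using measurable_tail_distance measurable_cong_sets[OF sets_pair_law refl] by auto
    show "AE w in pair_law. tail_distance w \<le> (\<integral>u. tail_distance u \<partial>pair_step n w)"
      using M by eventually_elim (auto intro: tail_distance_subharmonic)
  qed (auto intro: tail_distance_bounds pair_law_invariant)
  then have "AE w in pair_law. \<forall>n. AE u in pair_step n w. tail_distance u = tail_distance w"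
    by (simp add: AE_all_countable)
  with M show ?thesis by eventually_elim (auto simp: rigid_def)
qed

section \<open>The zero-two law and the equivalence\<close>

text \<open>
  If the information at time \<open>n\<close> does not change the probability of \<open>A\<close>, then \<open>A\<close> is independent of
  this information. The information at all times together determines the path, so \<open>A\<close> is
  independent of itself.
\<close>

lemma zero_one_of_constant_continuation:
  assumes x: "Markov_from x" and A: "A \<in> tail_Z"
    and const: "\<And>n A'. A' \<in> tail_Z \<Longrightarrow> A = shift (int n) -` A' \<Longrightarrow> AE u in step n x. measure (K u) A' = measure (K x) A"
  shows "measure (K x) A = (measure (K x) A)\<^sup>2"
proof -
  interpret Kx: prob_space "K x" by (rule K_props)
  define \<V> where "\<V> n = {(\<lambda>\<omega>::('g, 'f) path. observed (shift (int n) \<omega>)) -` B | B. B \<in> sets borel}" for n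
  show ?thesis
  proof (rule Kx.zero_one_of_indep_approximation[where \<V>=\<V>])
    show "incseq \<V>"
    proof (rule incseq_SucI, rule subsetI)
      fix n V assume "V \<in> \<V> n"
      then obtain B where B: "V = (\<lambda>\<omega>. observed (shift (int n) \<omega>)) -` B" "B \<in> sets borel"
        by (auto simp: \<V>_def)
      have "rewind 1 (observed (shift (int (Suc n)) \<omega>)) = observed (shift (int n) \<omega>)" for \<omega> :: "('g, 'f) path"
        using rewind_observed[of 1 "shift (int n) \<omega>"] by (simp add: ac_simps)
      then have "V = (\<lambda>\<omega>. observed (shift (int (Suc n)) \<omega>)) -` (rewind 1 -` B)"
        unfolding B(1) by (simp only: vimage_def mem_Collect_eq)
      moreover have "rewind 1 -` B \<in> sets borel"
        using measurable_sets[OF measurable_rewind B(2), of 1] by simp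
      ultimately show "V \<in> \<V> (Suc n)" unfolding \<V>_def by blast
    qed
    show "\<V> n \<subseteq> Kx.events" for n
      using measurable_sets[OF observed_shift] by (auto simp: \<V>_def K_props)
    show "Int_stable (\<V> n)" for n
    proof (rule Int_stableI)
      fix V V' assume "V \<in> \<V> n" "V' \<in> \<V> n"
      then obtain B B' where B: "V = (\<lambda>\<omega>. observed (shift (int n) \<omega>)) -` B" "B \<in> sets borel"
        "V' = (\<lambda>\<omega>. observed (shift (int n) \<omega>)) -` B'" "B' \<in> sets borel"
        by (auto simp: \<V>_def)
      have "V \<inter> V' = (\<lambda>\<omega>. observed (shift (int n) \<omega>)) -` (B \<inter> B')" unfolding B(1,3) by blast
      then show "V \<inter> V' \<in> \<V> n" using B(2,4) unfolding \<V>_def by blast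
    qed
    have sub: "(\<Union>n. \<V> n) \<subseteq> Pow UNIV" by simp
    define N where "N = sigma UNIV (\<Union>n. \<V> n)"
    have setsN: "sets N = sigma_sets UNIV (\<Union>n. \<V> n)" and spN: "space N = UNIV"
      by (simp_all add: N_def space_measure_of_conv)
    have obs: "(\<lambda>\<omega>. observed (shift (int n) \<omega>)) \<in> N \<rightarrow>\<^sub>M borel" for n
    proof (rule measurableI)
      fix B :: "((int \<Rightarrow> 'f) \<times> (nat \<Rightarrow> 'g)) set" assume "B \<in> sets borel"
      then have "(\<lambda>\<omega>. observed (shift (int n) \<omega>)) -` B \<in> (\<Union>n. \<V> n)" by (auto simp: \<V>_def)
      then show "(\<lambda>\<omega>. observed (shift (int n) \<omega>)) -` B \<inter> space N \<in> sets N"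
        by (auto simp: spN setsN)
    qed simp
    \<comment> \<open>\<open>Z\<^sub>k\<close> belongs to the information at time \<open>max k 0 = nat k\<close>, where it lies \<open>nat k - k\<close> steps back.\<close>
    have "(\<lambda>\<omega>::('g, 'f) path. \<omega> k) \<in> N \<rightarrow>\<^sub>M borel" for k
    proof -
      have y: "(\<lambda>\<omega>. fst (observed (shift (int 0) \<omega>)) k) \<in> N \<rightarrow>\<^sub>M borel"
        by (rule measurable_compose[OF obs measurable_compose[OF borel_measurable_fst measurable_product_coordinates]])
      have z: "(\<lambda>\<omega>. snd (observed (shift (int (nat k)) \<omega>)) (nat (int (nat k) - k))) \<in> N \<rightarrow>\<^sub>M borel"
        by (rule measurable_compose[OF obs measurable_compose[OF borel_measurable_snd measurable_product_coordinates]])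
      have "(\<lambda>\<omega>::('g, 'f) path. \<omega> k) = (\<lambda>\<omega>. (snd (observed (shift (int (nat k)) \<omega>)) (nat (int (nat k) - k)),
          fst (observed (shift (int 0) \<omega>)) k))"
        by (auto simp: fun_eq_iff observed_def past_def Z_path_def Z_coord_def Y_path_def Y_coord_def shift_def)
      then show ?thesis using borel_measurable_Pair[OF z y] by simp
    qed
    then have "(\<lambda>\<omega>::('g, 'f) path. \<omega>) \<in> N \<rightarrow>\<^sub>M borel"
      by (rule measurable_coordinatewise_then_product)
    from measurable_sets[OF this tail_Z_sets[OF A]]
    show "A \<in> sigma_sets (space (K x)) (\<Union>n. \<V> n)" by (simp add: spN setsN K_props)
    fix n V assume "V \<in> \<V> n"
    then obtain B where V: "V = (\<lambda>\<omega>. observed (shift (int n) \<omega>)) -` B" and B: "B \<in> sets borel"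
      by (auto simp: \<V>_def)
    obtain A' where A': "A' \<in> tail_Z" "A = shift (int n) -` A'" using A by (rule tail_Z_shift)
    have meas: "(\<lambda>u. measure (K u) A') \<in> borel_measurable (step n x)" "B \<in> sets (step n x)"
      using measurable_measure_K[OF tail_Z_sets[OF A'(1)]] B by (simp_all add: step_props(2) cong: measurable_cong_sets)
    have "Kx.prob (A \<inter> V) = (\<integral>u. indicator B u * measure (K u) A' \<partial>step n x)"
      using Markov_from_measure[OF x tail_Z_sets[OF A'(1)] B, of n] A'(2) V by (simp add: Int_commute)
    also have "\<dots> = (\<integral>u. indicator B u * measure (K x) A \<partial>step n x)"
      using const[OF A'] meas by (intro integral_cong_AE) (auto elim: eventually_mono)
    also have "\<dots> = measure (step n x) B * measure (K x) A"
      using B by (simp add: step_props)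
    also have "measure (step n x) B = Kx.prob V"
      unfolding step_def using B observed_shift by (subst measure_distr) (auto simp: measurable_K K_props V)
    finally show "Kx.prob (A \<inter> V) = Kx.prob A * Kx.prob V" by (simp add: mult.commute)
  qed
qed

text \<open>
  For a rigid pair and \<open>A = shift n -` A'\<close>, the difference \<open>K u A' - K u' A'\<close> is at most half the constant
  distance and has this bound as its mean, so it is almost surely constant under a product
  measure. Then each of its two terms is constant.
\<close>

lemma zero_one_of_extremal:
  assumes r: "rigid x x'" and A: "A \<in> tail_Z"
    and ext: "2 * (measure (K x) A - measure (K x') A) = tail_distance (x, x')"
  shows "measure (K x) A = (measure (K x) A)\<^sup>2" "measure (K x') A = (measure (K x') A)\<^sup>2"
proof -
  have M: "Markov_from x" "Markov_from x'" using r by (auto simp: rigid_def)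
  have const: "(AE u in step n x. measure (K u) A' = measure (K x) A) \<and> (AE u in step n x'. measure (K u) A' = measure (K x') A)"
    if A': "A' \<in> tail_Z" "A = shift (int n) -` A'" for n A'
  proof -
    interpret S: prob_space "step n x" by (rule step_props)
    interpret S': prob_space "step n x'" by (rule step_props)
    interpret PP: pair_prob_space "step n x" "step n x'" ..
    interpret T: prob_space "pair_step n (x, x')" by (rule pair_step_props)
    note ps = pair_step_tail[OF M tail_Z_sets[OF A'(1)], of n, folded A'(2)]
    note ps' = pair_step_tail(3)[OF M(2) M(2) tail_Z_sets[OF A'(1)], of n, folded A'(2)]
    let ?d = "\<lambda>w. case w of (u, u') \<Rightarrow> measure (K u) A' - measure (K u') A'"
    let ?g = "\<lambda>w. tail_distance (x, x') / 2 - ?d w"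
    have "AE w in pair_step n (x, x'). 0 \<le> ?g w"
      using r[unfolded rigid_def, THEN conjunct2, THEN conjunct2, rule_format, of n]
    proof eventually_elim
      case (elim w)
      obtain u u' where w: "w = (u, u')" by (cases w)
      have "2 * (measure (K u) A' - measure (K u') A') \<le> 2 * \<bar>measure (K u) A' - measure (K u') A'\<bar>"
        by (intro mult_left_mono abs_ge_self) simp
      also have "\<dots> \<le> tail_distance (u, u')" using A'(1) by (rule tail_distance_upper)
      finally show ?case using elim by (simp add: w)
    qed
    moreover have gi: "integrable (pair_step n (x, x')) ?g" using ps(1) by simp
    moreover have "(\<integral>w. ?g w \<partial>pair_step n (x, x')) = 0"
      using ps(1,2) ext by (simp add: T.prob_space)
    ultimately have "AE w in pair_step n (x, x'). ?g w = 0"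
      using integral_nonneg_eq_0_iff_AE[of "pair_step n (x, x')" ?g] by blast
    then have "AE w in step n x \<Otimes>\<^sub>M step n x'. ?g w = 0" unfolding pair_step_def prod.case .
    then have sections: "AE u in step n x. AE u' in step n x'. ?g (u, u') = 0" by (rule PP.AE_pair)
    have m: "(\<lambda>u. measure (K u) A') \<in> borel_measurable (step n x')"
      using measurable_measure_K[OF tail_Z_sets[OF A'(1)]] by (simp add: step_props(2) cong: measurable_cong_sets)
    \<comment> \<open>For almost every fixed \<open>u\<close> the term in \<open>u'\<close> is constant, hence equal to its mean \<open>K x' A\<close>.\<close>
    have both: "AE u in step n x. measure (K u) A' = measure (K x) A \<and> (AE u' in step n x'. measure (K u') A' = measure (K x') A)"
      using sections
    proof eventually_elim
      case (elim u)
      have c: "AE u' in step n x'. measure (K u') A' = measure (K u) A' - tail_distance (x, x') / 2"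
        using elim by eventually_elim (simp add: field_simps)
      have "measure (K x') A = (\<integral>u'. measure (K u) A' - tail_distance (x, x') / 2 \<partial>step n x')"
        unfolding ps'[symmetric] using c m by (intro integral_cong_AE) auto
      then have "measure (K x') A = measure (K u) A' - tail_distance (x, x') / 2"
        by (simp add: S'.prob_space)
      with c ext show ?case by auto
    qed
    then have "AE u in step n x. measure (K u) A' = measure (K x) A" by eventually_elim simp
    moreover from both have "AE u in step n x. (AE u' in step n x'. measure (K u') A' = measure (K x') A)" by eventually_elim simp
    then have "AE u' in step n x'. measure (K u') A' = measure (K x') A" by simp
    ultimately show ?thesis ..
  qed
  show "measure (K x) A = (measure (K x) A)\<^sup>2"
    using const by (intro zero_one_of_constant_continuation M A) blast
  show "measure (K x') A = (measure (K x') A)\<^sup>2"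
    using const by (intro zero_one_of_constant_continuation M A) blast
qed

text \<open>
  An optimal tail event has probability \<open>0\<close> or \<open>1\<close> under both measures.
\<close>

lemma tail_distance_zero_or_two:
  assumes "rigid x x'"
  shows "tail_distance (x, x') = 0 \<or> tail_distance (x, x') = 2"
proof -
  obtain D where D: "D \<in> tail_Z" "2 * (measure (K x) D - measure (K x') D) = tail_distance (x, x')"
    by (rule tail_distance_attained)
  from zero_one_of_extremal[OF assms D]
  have "measure (K x) D = 0 \<or> measure (K x) D = 1" "measure (K x') D = 0 \<or> measure (K x') D = 1"
    by (auto simp: power2_eq_square)
  with D(2) tail_distance_bounds[of "(x, x')"] show ?thesis by auto
qed

lemma tv_tendsto_0_iff:
  "(\<lambda>n. tv_on (sets (F_Z {int n..})) (K x) (K x')) \<longlonglongrightarrow> 0 \<longleftrightarrow> tail_distance (x, x') = 0"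
  using tail_distance_limit[of x x'] LIMSEQ_unique by metis

text \<open>
  If the distance vanishes, every tail event is optimal, so \<open>zero_one_of_extremal\<close> applies to all of
  them.
\<close>

lemma tail_zero_one_iff:
  assumes "rigid x x'"
  shows "(\<forall>A\<in>tail_Z. measure (K x) A = (measure (K x) A)\<^sup>2 \<and> (measure (K x) A)\<^sup>2 = measure (K x') A)
    \<longleftrightarrow> tail_distance (x, x') = 0"
proof
  assume eq: "\<forall>A\<in>tail_Z. measure (K x) A = (measure (K x) A)\<^sup>2 \<and> (measure (K x) A)\<^sup>2 = measure (K x') A"
  obtain D where "D \<in> tail_Z" "2 * (measure (K x) D - measure (K x') D) = tail_distance (x, x')"
    by (rule tail_distance_attained)
  with eq show "tail_distance (x, x') = 0" by auto
next
  assume 0: "tail_distance (x, x') = 0"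
  show "\<forall>A\<in>tail_Z. measure (K x) A = (measure (K x) A)\<^sup>2 \<and> (measure (K x) A)\<^sup>2 = measure (K x') A"
  proof
    fix A :: "('g, 'f) path set" assume A: "A \<in> tail_Z"
    then have "measure (K x) A = measure (K x') A" using tail_distance_upper[OF A, of x x'] 0 by simp
    moreover from this have "measure (K x) A = (measure (K x) A)\<^sup>2"
      using 0 by (intro zero_one_of_extremal[OF assms A]) simp
    ultimately show "measure (K x) A = (measure (K x) A)\<^sup>2 \<and> (measure (K x) A)\<^sup>2 = measure (K x') A" by simp
  qed
qed

text \<open>
  Since the distances converge to the tail distance, some of them is below \<open>2\<close> as soon as the limit is.
\<close>

lemma not_singular_iff:
  "(\<exists>n. \<not> mutually_singular_on (sets (F_Z {int n..})) (K x) (K x')) \<longleftrightarrow> tail_distance (x, x') < 2"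
proof -
  have "\<not> mutually_singular_on (sets (F_Z {int n..})) (K x) (K x') \<longleftrightarrow> tv_on (sets (F_Z {int n..})) (K x) (K x') < 2" for n
    using tv_on_less_2_iff_not_singular[OF sigma_algebra_F_Z K_props(1,3) F_Z_K K_props(1,3) F_Z_K] by simp
  moreover have "(\<exists>n. tv_on (sets (F_Z {int n..})) (K x) (K x') < 2) \<longleftrightarrow> tail_distance (x, x') < 2"
  proof
    assume "\<exists>n. tv_on (sets (F_Z {int n..})) (K x) (K x') < 2"
    then obtain n where n: "tv_on (sets (F_Z {int n..})) (K x) (K x') < 2" by blast
    have "tv_on tail_Z (K x) (K x') \<le> tv_on (sets (F_Z {int n..})) (K x) (K x')"
      by (rule tv_on_mono) (auto simp: K_props tail_Z_def)
    with n show "tail_distance (x, x') < 2" by (simp add: tail_distance_def)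
  next
    assume "tail_distance (x, x') < 2"
    from order_tendstoD(2)[OF tail_distance_limit this]
    show "\<exists>n. tv_on (sets (F_Z {int n..})) (K x) (K x') < 2"
      using eventually_happens[of _ sequentially] by auto
  qed
  ultimately show ?thesis by simp
qed

end

theorem theorem3p2:
  fixes P :: "('g::polish_space, 'f::polish_space) path measure"
    and Py :: "(int \<Rightarrow> 'f) \<Rightarrow> ('g, 'f) path measure"
    and Pyz :: "(int \<Rightarrow> 'f) \<times> (nat \<Rightarrow> 'g) \<Rightarrow> ('g, 'f) path measure"
  assumes "prob_space P" and "sets P = sets borel" and "stationary P"
    and "regular_cond_prob P (F_Y UNIV) Y_path Py"
    and "regular_cond_prob P (field_join (F_Y UNIV) (F_Z {..0}))
           (\<lambda>\<omega>. (Y_path \<omega>, past (Z_path \<omega>))) Pyz"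
  shows "((AE (z, z', y) in coupling P Py.
             (\<lambda>n::nat. tv_on (sets (F_Z {int n..})) (Pyz (y, past z)) (Pyz (y, past z')))
               \<longlonglongrightarrow> 0)
          \<longleftrightarrow>
          (AE (z, z', y) in coupling P Py. \<forall>A\<in>tail_Z.
             measure (Pyz (y, past z)) A = (measure (Pyz (y, past z)) A)\<^sup>2 \<and>
             (measure (Pyz (y, past z)) A)\<^sup>2 = measure (Pyz (y, past z')) A))
       \<and> ((AE (z, z', y) in coupling P Py. \<forall>A\<in>tail_Z.
             measure (Pyz (y, past z)) A = (measure (Pyz (y, past z)) A)\<^sup>2 \<and>
             (measure (Pyz (y, past z)) A)\<^sup>2 = measure (Pyz (y, past z')) A)
          \<longleftrightarrow>
          (AE (z, z', y) in coupling P Py. \<exists>n::nat.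
             \<not> mutually_singular_on (sets (F_Z {int n..}))
                 (Pyz (y, past z)) (Pyz (y, past z'))))"
proof -
  interpret conditioned_process P Py Pyz
    by (rule conditioned_process.intro) (use assms in \<open>simp_all add: observed_def[abs_def]\<close>)
  have rigid: "AE (z, z', y) in coupling P Py. rigid (y, past z) (y, past z')"
    by (rule AE_coupling[OF AE_rigid])
  show ?thesis
  proof (intro conjI eventually_subst)
    show "AE w in coupling P Py. (case w of (z, z', y) \<Rightarrow>
        (\<lambda>n::nat. tv_on (sets (F_Z {int n..})) (Pyz (y, past z)) (Pyz (y, past z'))) \<longlonglongrightarrow> 0) =
      (case w of (z, z', y) \<Rightarrow> \<forall>A\<in>tail_Z.
        measure (Pyz (y, past z)) A = (measure (Pyz (y, past z)) A)\<^sup>2 \<and>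
        (measure (Pyz (y, past z)) A)\<^sup>2 = measure (Pyz (y, past z')) A)"
      using rigid
    proof eventually_elim
      case (elim w)
      obtain z z' y where w: "w = (z, z', y)" by (cases w)
      from elim show ?case
        unfolding w prod.case tv_tendsto_0_iff by (rule tail_zero_one_iff[symmetric])
    qed
    show "AE w in coupling P Py. (case w of (z, z', y) \<Rightarrow> \<forall>A\<in>tail_Z.
        measure (Pyz (y, past z)) A = (measure (Pyz (y, past z)) A)\<^sup>2 \<and>
        (measure (Pyz (y, past z)) A)\<^sup>2 = measure (Pyz (y, past z')) A) =
      (case w of (z, z', y) \<Rightarrow> \<exists>n::nat.
        \<not> mutually_singular_on (sets (F_Z {int n..})) (Pyz (y, past z)) (Pyz (y, past z')))"
      using rigid
    proof eventually_elim
      case (elim w)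
      obtain z z' y where w: "w = (z, z', y)" by (cases w)
      from elim have r: "rigid (y, past z) (y, past z')" by (simp add: w)
      show ?case
        unfolding w prod.case not_singular_iff tail_zero_one_iff[OF r]
        using tail_distance_zero_or_two[OF r] by auto
    qed
  qed
qed

end
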